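(* Consider the stochastic block model $G_N$ with $M$ blocks of equal size $N/M$, with identical intra-block edge probabilities $p_1=\dots=p_M=p=p(N)$ and inter-block edge probability $q=q(N)$. Assume that $$\frac{M\log^4N}{Np+N(M-1)q}\xrightarrow[N\to\infty]{}0\qquad\text{and}\qquad q\gg\sqrt{\frac{p\log N}{NM}},$$ and that the limit $\kappa=\lim_{N\to\infty}\frac{(M-1)q}{p}\in[0,\infty]$ is well defined. Then, for $v\in V_N$, $$H^v=N(1+o(1))$$ asymptotically almost surely.
   Context: Model: $M$ is the (fixed) number of blocks and $N\to\infty$ runs through multiples of $M$ with $M<N$. The vertex set $V=V_N=\{1,\dots,N\}$ is partitioned into blocks $V^{(1)},\dots,V^{(M)}$ of size $N/M$ each. $p,q\in[0,1]$ depend on $N$. In the random graph $G_N=(V_N,E_N)$ the edge indicators of the unordered pairs $\{v,w\}$ (loops $v=w$ allowed) are independent; the edge $\{v,w\}$ is present with probability $p$ if $v,w$ are in the same block, and with probability $q$ if they are in different blocks. $a_{v,w}$ is the indicator of the edge $\{v,w\}$, $d_v=\sum_{w\in V}a_{v,w}$ (a loop counts once). $E$ is the edge set (including loops) and $L$ the set of loops, so $\sum_v d_v=2|E|-|L|$. Random walk: for a realization of $G_N$, the simple random walk in discrete time jumps from $v$ to $w$ with probability $1/d_v$ if $\{v,w\}\in E$, and $0$ otherwise. Its invariant distribution is $\pi_v=d_v/(2|E|-|L|)$. $H_{vw}$ is the expected time for the walk started in $v$ to reach $w$ (so $H_{ww}=0$), a random variable through the graph. Define $H^v=\sum_{w\in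 V}\pi_wH_{vw}$. The realization is tacitly assumed connected. Conventions: $b_N\gg a_N$ means $a_N/b_N\to0$. An event holds asymptotically almost surely (a.a.s.) if its probability tends to $1$ as $N\to\infty$; "$X_N=x_N(1+o(1))$ a.a.s." means that there is a deterministic sequence $\delta_N\to0$ with $|X_N/x_N-1|\le\delta_N$ a.a.s. *)

theory Defs
  imports "HOL-Probability.Probability"
begin

section \<open>The stochastic block model\<close>

text \<open>
  The number of vertices runs through the proper multiples of the fixed number \<open>M\<close> of blocks.
\<close>

definition admissible :: "nat \<Rightarrow> nat \<Rightarrow> bool" where
  "admissible M N \<longleftrightarrow> M dvd N \<and> M < N"

definition sizes :: "nat \<Rightarrow> nat filter" where
  "sizes M = inf sequentially (principal {N. admissible M N})"

definition equal_blocks :: "nat \<Rightarrow> nat \<Rightarrow> (nat \<Rightarrow> nat set) \<Rightarrow> bool" where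
  "equal_blocks M N B \<longleftrightarrow>
     disjoint_family_on B {1..M} \<and> (\<Union>i\<in>{1..M}. B i) = {1..N} \<and>
     (\<forall>i\<in>{1..M}. card (B i) = N div M)"

text \<open>
  An edge is the set of its end points, so that a loop is a singleton.
  A realization of the random graph is given by its edge set.
\<close>

definition vertex_pairs :: "nat \<Rightarrow> nat set set" where
  "vertex_pairs N = {{v, w} | v w. v \<in> {1..N} \<and> w \<in> {1..N}}"

definition edge_prob :: "nat \<Rightarrow> (nat \<Rightarrow> nat set) \<Rightarrow> real \<Rightarrow> real \<Rightarrow> nat set \<Rightarrow> real" where
  "edge_prob M B p q e = (if \<exists>i\<in>{1..M}. e \<subseteq> B i then p else q)"

definition sbm :: "nat \<Rightarrow> nat \<Rightarrow> (nat \<Rightarrow> nat set) \<Rightarrow> real \<Rightarrow> real \<Rightarrow> nat set set pmf" where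
  "sbm M N B p q =
     map_pmf (\<lambda>a. {e \<in> vertex_pairs N. a e})
       (Pi_pmf (vertex_pairs N) False (\<lambda>e. bernoulli_pmf (edge_prob M B p q e)))"

definition neighbours :: "nat \<Rightarrow> nat set set \<Rightarrow> nat \<Rightarrow> nat set" where
  "neighbours N E v = {w \<in> {1..N}. {v, w} \<in> E}"

definition vertex_degree :: "nat \<Rightarrow> nat set set \<Rightarrow> nat \<Rightarrow> nat" where
  "vertex_degree N E v = (\<Sum>w\<in>{1..N}. of_bool ({v, w} \<in> E))"

definition loops :: "nat set set \<Rightarrow> nat set set" where
  "loops E = {e \<in> E. \<exists>v. e = {v}}"

definition connected_graph :: "nat \<Rightarrow> nat set set \<Rightarrow> bool" where
  "connected_graph N E \<longleftrightarrow>
     (\<forall>v\<in>{1..N}. \<forall>w\<in>{1..N}. (v, w) \<in> {(x, y). {x, y} \<in> E}\<^sup>*)"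


section \<open>Simple random walk and hitting times\<close>

text \<open>
  At an isolated vertex the walk is made to stay put; this never happens in a connected graph
  with at least two vertices.
\<close>

definition step_pmf :: "nat \<Rightarrow> nat set set \<Rightarrow> nat \<Rightarrow> nat pmf" where
  "step_pmf N E v =
     (if neighbours N E v = {} then return_pmf v else pmf_of_set (neighbours N E v))"

lemma vertex_degree_conv_card: "vertex_degree N E v = card (neighbours N E v)"
  by (simp add: vertex_degree_def neighbours_def of_bool_def sum.If_cases Int_def)

lemma pmf_step_pmf:
  assumes "neighbours N E v \<noteq> {}"
  shows "pmf (step_pmf N E v) w =
    (if w \<in> {1..N} \<and> {v, w} \<in> E then 1 / real (vertex_degree N E v) else 0)"
proof -
  have "finite (neighbours N E v)"
    by (simp add: neighbours_def)
  with assms show ?thesis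
    by (simp add: step_pmf_def vertex_degree_conv_card indicator_def)
       (auto simp: neighbours_def)
qed

text \<open>
  The law of the walk started in \<open>v\<close>, as a measure on trajectories \<open>nat \<Rightarrow> nat\<close>, by the theorem of
  Ionescu-Tulcea: the kernel gives the law of the position at time \<open>i\<close> given the
  trajectory \<open>\<omega>\<close> before time \<open>i\<close>.
\<close>

definition walk_kernel :: "nat \<Rightarrow> nat set set \<Rightarrow> nat \<Rightarrow> nat \<Rightarrow> (nat \<Rightarrow> nat) \<Rightarrow> nat measure" where
  "walk_kernel N E v i \<omega> =
     measure_pmf (if i = 0 then return_pmf v else step_pmf N E (\<omega> (i - 1)))"

definition walk :: "nat \<Rightarrow> nat set set \<Rightarrow> nat \<Rightarrow> (nat \<Rightarrow> nat) measure" where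
  "walk N E v =
     projective_family.lim UNIV
       (Ionescu_Tulcea.CI (walk_kernel N E v) (\<lambda>_. count_space UNIV)) (\<lambda>_. count_space UNIV)"

lemma Ionescu_Tulcea_walk: "Ionescu_Tulcea (walk_kernel N E v) (\<lambda>_. count_space UNIV)"
proof (rule Ionescu_Tulcea.intro)
  fix i
  have law: "measure_pmf r \<in> space (subprob_algebra (count_space UNIV))" for r :: "nat pmf"
    by (rule measure_pmf_in_subprob_algebra)
  show "walk_kernel N E v i \<in>
    measurable (PiM {0..<i} (\<lambda>_. count_space UNIV)) (subprob_algebra (count_space UNIV))"
  proof (cases "i = 0")
    case True
    then show ?thesis
      unfolding walk_kernel_def[abs_def] by (auto intro!: measurable_const law)
  next
    case False
    then have "(\<lambda>\<omega>. \<omega> (i - 1)) \<in>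
        measurable (PiM {0..<i} (\<lambda>_. count_space UNIV)) (count_space (UNIV :: nat set))"
      by (intro measurable_component_singleton) auto
    moreover have "(\<lambda>x. measure_pmf (step_pmf N E x)) \<in>
        measurable (count_space UNIV) (subprob_algebra (count_space UNIV))"
      by (auto simp: measurable_count_space_eq1 law)
    ultimately have "(\<lambda>\<omega>. measure_pmf (step_pmf N E (\<omega> (i - 1)))) \<in>
        measurable (PiM {0..<i} (\<lambda>_. count_space UNIV)) (subprob_algebra (count_space UNIV))"
      by (rule measurable_compose)
    then show ?thesis
      using False unfolding walk_kernel_def[abs_def] by simp
  qed
next
  fix i x
  show "prob_space (walk_kernel N E v i x)"
    by (simp only: walk_kernel_def measure_pmf.prob_space_axioms)
qed

text \<open>The infimum is \<open>\<infinity>\<close> for a trajectory that never visits \<open>w\<close>.\<close>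

definition hitting_time :: "nat \<Rightarrow> (nat \<Rightarrow> nat) \<Rightarrow> ennreal" where
  "hitting_time w \<omega> = (INF n\<in>{n. \<omega> n = w}. of_nat n)"

definition expected_hitting_time :: "nat \<Rightarrow> nat set set \<Rightarrow> nat \<Rightarrow> nat \<Rightarrow> ennreal" where
  "expected_hitting_time N E v w = (\<integral>\<^sup>+\<omega>. hitting_time w \<omega> \<partial>walk N E v)"

definition invariant_distr :: "nat \<Rightarrow> nat set set \<Rightarrow> nat \<Rightarrow> real" where
  "invariant_distr N E v = real (vertex_degree N E v) / (2 * real (card E) - real (card (loops E)))"

definition mean_hitting_time :: "nat \<Rightarrow> nat set set \<Rightarrow> nat \<Rightarrow> ennreal" where
  "mean_hitting_time N E v =
     (\<Sum>w\<in>{1..N}. ennreal (invariant_distr N E w) * expected_hitting_time N E v w)"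


section \<open>Asymptotics\<close>

text \<open>
  The denominator is required to be eventually positive because \<open>x / 0 = 0\<close> in HOL.
\<close>

definition dominates :: "nat filter \<Rightarrow> (nat \<Rightarrow> real) \<Rightarrow> (nat \<Rightarrow> real) \<Rightarrow> bool" where
  "dominates F b a \<longleftrightarrow> (\<forall>\<^sub>F N in F. b N > 0) \<and> ((\<lambda>N. a N / b N) \<longlongrightarrow> 0) F"

definition aas :: "nat filter \<Rightarrow> (nat \<Rightarrow> 'a pmf) \<Rightarrow> (nat \<Rightarrow> 'a \<Rightarrow> bool) \<Rightarrow> bool" where
  "aas F P A \<longleftrightarrow> ((\<lambda>N. measure_pmf.prob (P N) {x. A N x}) \<longlongrightarrow> 1) F"

end

theory Submission
  imports Defs "HOL-Real_Asymp.Real_Asymp"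
begin

text \<open>
  By the random target lemma \<open>H\<^sup>v\<close> does not depend on \<open>v\<close>, so it is the \<open>\<pi>\<close>-average over \<open>w\<close> of the
  means of the functions \<open>v \<mapsto> H\<^sub>v\<^sub>w\<close>. Such a function solves a Poisson equation, and expanding the
  solution to second order in the transition matrix gives the lower bound \<open>1/\<pi>\<^sub>w - 2\<close> and the upper
  bound \<open>1/\<pi>\<^sub>w (1 + 1/d + 1/(\<gamma> d))\<close> for its mean, where \<open>d\<close> is the least degree and \<open>\<gamma>\<close> a spectral gap.
  Hence \<open>N - 2 \<le> H\<^sup>v \<le> N (1 + 1/d + 1/(\<gamma> d))\<close>, and a rather weak gap suffices.

  Let \<open>D = (N p + N (M - 1) q) / M\<close> be the expected degree, and let \<open>r\<close> be \<open>q\<close>, or \<open>p\<close> if \<open>M = 1\<close>.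
  Chernoff bounds and union bounds show that all degrees are of order \<open>D\<close> and that every vertex set \<open>S\<close>
  has at least \<open>r |S| (N - |S|) / 8\<close> boundary edges. Cheeger's inequality turns this into a gap of order
  \<open>(N r / D)\<^sup>2\<close>, so that \<open>1/(\<gamma> d)\<close> is of order \<open>D / (N r)\<^sup>2\<close>. This tends to \<open>0\<close>: if \<open>M \<ge> 2\<close> then it
  equals \<open>p / (M N q\<^sup>2) + (M - 1) / (M N q)\<close>.
\<close>

section \<open>Hitting times as sums over the killed walk\<close>

text \<open>The transition operator of the walk killed at \<open>w\<close>. Values in
  \<open>ennreal\<close> allow sums over all times before the hitting times are known to be
  finite.\<close>

definition killed_step :: "nat \<Rightarrow> nat set set \<Rightarrow> nat \<Rightarrow> (nat \<Rightarrow> ennreal) \<Rightarrow> nat \<Rightarrow> ennreal" where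
  "killed_step N E w g x = (if x = w then 0 else \<integral>\<^sup>+y. g y \<partial>step_pmf N E x)"

text \<open>For \<open>g = 1\<close> this is the indicator that the hitting time of \<open>w\<close>
  exceeds \<open>n\<close>. A general \<open>g\<close> is kept for the induction on
  \<open>n\<close>.\<close>

definition avoiding :: "nat \<Rightarrow> nat \<Rightarrow> (nat \<Rightarrow> ennreal) \<Rightarrow> (nat \<Rightarrow> nat) \<Rightarrow> ennreal" where
  "avoiding w n g \<omega> = (if \<forall>k\<le>n. \<omega> k \<noteq> w then g (\<omega> n) else 0)"

text \<open>The index set \<open>J\<close> is left open because the function is integrated both over
  finite prefixes and over whole trajectories. Written as a product, the indicator depends on single
  coordinates.\<close>

lemma avoiding_measurable:
  assumes "{..n} \<subseteq> J"
  shows "avoiding w n g \<in> borel_measurable (PiM J (\<lambda>_. count_space UNIV))"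
proof -
  have c: "(\<lambda>\<omega>. \<omega> k) \<in> measurable (PiM J (\<lambda>_. count_space UNIV)) (count_space (UNIV :: nat set))"
    if "k \<le> n" for k
    using that assms by (intro measurable_component_singleton) auto
  have "(\<lambda>\<omega>. g (\<omega> n) * (\<Prod>k\<le>n. if \<omega> k \<noteq> w then 1 else 0)) \<in>
      borel_measurable (PiM J (\<lambda>_. count_space UNIV))"
  proof (intro borel_measurable_times_ennreal borel_measurable_prod_ennreal)
    show "(\<lambda>\<omega>. g (\<omega> n)) \<in> borel_measurable (PiM J (\<lambda>_. count_space UNIV))"
      by (rule measurable_compose[OF c]) auto
    show "(\<lambda>\<omega>. if \<omega> k \<noteq> w then 1 else 0 :: ennreal) \<in> borel_measurable (PiM J (\<lambda>_. count_space UNIV))"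
      if "k \<in> {..n}" for k
      by (rule measurable_compose[OF c]) (use that in auto)
  qed
  also have "(\<lambda>\<omega>. g (\<omega> n) * (\<Prod>k\<le>n. if \<omega> k \<noteq> w then 1 else 0)) = avoiding w n g"
  proof
    fix \<omega> :: "nat \<Rightarrow> nat"
    show "g (\<omega> n) * (\<Prod>k\<le>n. if \<omega> k \<noteq> w then 1 else 0) = avoiding w n g \<omega>"
    proof (cases "\<forall>k\<le>n. \<omega> k \<noteq> w")
      case True
      then show ?thesis by (simp add: avoiding_def)
    next
      case False
      then have "(\<Prod>k\<le>n. if \<omega> k \<noteq> w then 1 else (0::ennreal)) = 0"
        by (intro prod_zero) auto
      with False show ?thesis unfolding avoiding_def by simp
    qed
  qed
  finally show ?thesis .
qed

text \<open>The Markov property: integrating out the last position replaces \<open>g\<close> by its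
  one-step mean, hence the induction with arbitrary \<open>g\<close>. \<open>C 0 (Suc n)\<close> is
  the law of the first \<open>n + 1\<close> positions.\<close>

lemma nn_integral_avoiding_prefix:
  "(\<integral>\<^sup>+\<omega>. avoiding w n g \<omega> \<partial>Ionescu_Tulcea.C (walk_kernel N E v) (\<lambda>_. count_space UNIV) 0 (Suc n) (\<lambda>_. undefined)) =
     (killed_step N E w ^^ n) (\<lambda>x. if x = w then 0 else g x) v"
proof -
  interpret IT: Ionescu_Tulcea "walk_kernel N E v" "\<lambda>_. count_space UNIV"
    by (rule Ionescu_Tulcea_walk)
  \<comment> \<open>The empty history, the only point of the product over no coordinates.\<close>
  let ?u = "\<lambda>_. undefined :: nat"
  have u: "?u \<in> space (PiM {0..<0::nat} (\<lambda>_. count_space UNIV))"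
    by (simp add: space_PiM)
  have step: "(\<integral>\<^sup>+\<omega>. F \<omega> \<partial>IT.C 0 (Suc n) ?u) =
      (\<integral>\<^sup>+\<omega>. (\<integral>\<^sup>+y. F (fun_upd \<omega> n y) \<partial>walk_kernel N E v n \<omega>) \<partial>IT.C 0 n ?u)"
    if F: "F \<in> borel_measurable (PiM {0..<Suc n} (\<lambda>_. count_space UNIV))" for F :: "_ \<Rightarrow> ennreal" and n
  proof -
    have "(\<integral>\<^sup>+\<omega>. F \<omega> \<partial>IT.C 0 (Suc n) ?u) = (\<integral>\<^sup>+\<omega>. (\<integral>\<^sup>+\<omega>'. F \<omega>' \<partial>IT.eP n \<omega>) \<partial>IT.C 0 n ?u)"
      using F IT.measurable_eP[of n] IT.sets_C[OF u, of n]
      by (simp add: nn_integral_bind[where B = "PiM {0..<Suc n} (\<lambda>_. count_space UNIV)"]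
           measurable_cong_sets[OF IT.sets_C[OF u, of n] refl] del: PiM_cong)
    also have "\<dots> = (\<integral>\<^sup>+\<omega>. (\<integral>\<^sup>+y. F (fun_upd \<omega> n y) \<partial>walk_kernel N E v n \<omega>) \<partial>IT.C 0 n ?u)"
      by (intro nn_integral_cong IT.nn_integral_eP F) (simp add: IT.space_C[OF u])
    finally show ?thesis .
  qed
  show ?thesis
  proof (induction n arbitrary: g)
    case 0
    have "(\<integral>\<^sup>+\<omega>. avoiding w 0 g \<omega> \<partial>IT.C 0 (Suc 0) ?u) =
      (\<integral>\<^sup>+\<omega>. (\<integral>\<^sup>+y. avoiding w 0 g (fun_upd \<omega> 0 y) \<partial>walk_kernel N E v 0 \<omega>) \<partial>IT.C 0 0 ?u)"
      by (rule step) (rule avoiding_measurable, auto)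
    also have "\<dots> = (\<integral>\<^sup>+\<omega>. (if v = w then 0 else g v) \<partial>IT.C 0 0 ?u)"
      by (intro nn_integral_cong) (simp add: walk_kernel_def avoiding_def)
    also have "\<dots> = (if v = w then 0 else g v)"
      using prob_space.emeasure_space_1[OF IT.prob_space_C[OF u, of 0]] by simp
    finally show ?case by simp
  next
    case (Suc n)
    let ?g = "\<lambda>x. \<integral>\<^sup>+y. (if y = w then 0 else g y) \<partial>step_pmf N E x"
    have "(\<integral>\<^sup>+\<omega>. avoiding w (Suc n) g \<omega> \<partial>IT.C 0 (Suc (Suc n)) ?u) =
      (\<integral>\<^sup>+\<omega>. (\<integral>\<^sup>+y. avoiding w (Suc n) g (fun_upd \<omega> (Suc n) y) \<partial>walk_kernel N E v (Suc n) \<omega>) \<partial>IT.C 0 (Suc n) ?u)"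
      by (rule step) (rule avoiding_measurable, auto)
    also have "\<dots> = (\<integral>\<^sup>+\<omega>. avoiding w n ?g \<omega> \<partial>IT.C 0 (Suc n) ?u)"
    proof (intro nn_integral_cong)
      fix \<omega> :: "nat \<Rightarrow> nat"
      define b where "b \<longleftrightarrow> (\<forall>k\<le>n. \<omega> k \<noteq> w)"
      have 1: "avoiding w (Suc n) g (fun_upd \<omega> (Suc n) y) = (if b then (if y = w then 0 else g y) else 0)" for y
        by (auto simp: avoiding_def le_Suc_eq b_def)
      have 2: "avoiding w n ?g \<omega> = (if b then ?g (\<omega> n) else 0)"
        by (simp only: avoiding_def b_def)
      show "(\<integral>\<^sup>+y. avoiding w (Suc n) g (fun_upd \<omega> (Suc n) y) \<partial>walk_kernel N E v (Suc n) \<omega>) = avoiding w n ?g \<omega>"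
        unfolding 1 2 walk_kernel_def by (cases b) simp_all
    qed
    also have "\<dots> = (killed_step N E w ^^ n) (\<lambda>x. if x = w then 0 else ?g x) v"
      by (rule Suc)
    also have "(\<lambda>x. if x = w then 0 else ?g x) = killed_step N E w (\<lambda>x. if x = w then 0 else g x)"
      by (simp add: killed_step_def fun_eq_iff)
    also have "(killed_step N E w ^^ n) \<dots> = (killed_step N E w ^^ Suc n) (\<lambda>x. if x = w then 0 else g x)"
      by (simp only: funpow_Suc_right o_apply)
    finally show ?case .
  qed
qed

text \<open>The integrand depends on the first \<open>n + 1\<close> positions only, so the
  projective limit may be replaced by its marginal on these coordinates.\<close>

lemma nn_integral_avoiding_walk:
  "(\<integral>\<^sup>+\<omega>. avoiding w n (\<lambda>_. 1) \<omega> \<partial>walk N E v) =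
     (killed_step N E w ^^ n) (\<lambda>x. if x = w then 0 else 1) v"
proof -
  interpret IT: Ionescu_Tulcea "walk_kernel N E v" "\<lambda>_. count_space UNIV"
    by (rule Ionescu_Tulcea_walk)
  let ?J = "{0..<Suc n}" and ?F = "avoiding w n (\<lambda>_. 1)"
  let ?Pi = "PiM ?J (\<lambda>_. count_space (UNIV :: nat set))"
  have J: "IT.up_to ?J = Suc n"
    by (intro antisym) (auto simp: IT.up_to_iff IT.up_to_less Suc_le_eq)
  have m: "?F \<in> borel_measurable ?Pi"
    by (rule avoiding_measurable) auto
  have u: "(\<lambda>_. undefined :: nat) \<in> space (PiM {0..<0::nat} (\<lambda>_. count_space UNIV))"
    by (simp add: space_PiM)
  have restrict: "?F (restrict \<omega> ?J) = ?F \<omega>" for \<omega>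
    by (auto simp: avoiding_def)
  have "(\<integral>\<^sup>+\<omega>. ?F \<omega> \<partial>walk N E v) = (\<integral>\<^sup>+\<omega>. ?F (restrict \<omega> ?J) \<partial>IT.PF.lim)"
    by (simp only: restrict walk_def)
  also have "\<dots> = (\<integral>\<^sup>+\<omega>. ?F \<omega> \<partial>distr IT.PF.lim ?Pi (\<lambda>\<omega>. restrict \<omega> ?J))"
    by (subst nn_integral_distr)
       (use m in \<open>auto intro!: measurable_restrict measurable_component_singleton simp: measurable_cong_sets[OF IT.PF.sets_lim refl]\<close>)
  also have "\<dots> = (\<integral>\<^sup>+\<omega>. ?F \<omega> \<partial>IT.CI ?J)"
    by (subst IT.distr_lim) auto
  also have "\<dots> = (\<integral>\<^sup>+\<omega>. ?F (restrict \<omega> ?J) \<partial>IT.C 0 (Suc n) (\<lambda>_. undefined))"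
    unfolding IT.CI_def J
    by (subst nn_integral_distr)
       (use m in \<open>auto intro!: measurable_restrict measurable_component_singleton simp: measurable_cong_sets[OF IT.sets_C[OF u] refl] simp del: IT.C.simps\<close>)
  also have "\<dots> = (killed_step N E w ^^ n) (\<lambda>x. if x = w then 0 else 1) v"
    unfolding restrict by (rule nn_integral_avoiding_prefix)
  finally show ?thesis .
qed

text \<open>The series counts the times before the first visit to \<open>w\<close>. Without a visit
  both sides are infinite.\<close>

lemma hitting_time_conv_suminf: "hitting_time w \<omega> = (\<Sum>n. avoiding w n (\<lambda>_. 1) \<omega>)"
proof (cases "\<exists>n. \<omega> n = w")
  case True
  define L where "L = (LEAST n. \<omega> n = w)"
  have L: "\<omega> L = w" "\<And>k. \<omega> k = w \<Longrightarrow> L \<le> k"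
    using True unfolding L_def by (auto intro: LeastI_ex Least_le)
  have avoid: "(\<forall>k\<le>n. \<omega> k \<noteq> w) \<longleftrightarrow> n < L" for n
  proof
    show "n < L" if "\<forall>k\<le>n. \<omega> k \<noteq> w"
      using that L(1) not_le by blast
    show "\<forall>k\<le>n. \<omega> k \<noteq> w" if "n < L"
      using that L(2) by fastforce
  qed
  have "hitting_time w \<omega> = of_nat L"
    unfolding hitting_time_def
    by (intro antisym INF_lower INF_greatest) (use L in auto)
  moreover have "(\<Sum>n. avoiding w n (\<lambda>_. 1) \<omega>) = (\<Sum>n<L. 1)"
    unfolding avoiding_def avoid by (subst suminf_finite[of "{..<L}"]) auto
  ultimately show ?thesis by simp
next
  case False
  have "(\<Sum>n. avoiding w n (\<lambda>_. 1) \<omega>) = (\<Sum>n. 1::ennreal)"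
    using False by (simp add: avoiding_def)
  also have "\<dots> = (SUP n::nat. \<Sum>i<n. 1)" by (rule suminf_eq_SUP)
  also have "\<dots> = top" by (simp add: ennreal_SUP_of_nat_eq_top)
  finally show ?thesis using False by (simp add: hitting_time_def)
qed

text \<open>The tail-sum formula for an expectation; nonnegativity allows the exchange of sum and
  integral.\<close>

lemma expected_hitting_time_conv_suminf:
  "expected_hitting_time N E v w = (\<Sum>n. (killed_step N E w ^^ n) (\<lambda>x. if x = w then 0 else 1) v)"
proof -
  interpret IT: Ionescu_Tulcea "walk_kernel N E v" "\<lambda>_. count_space UNIV"
    by (rule Ionescu_Tulcea_walk)
  have "avoiding w n (\<lambda>_. 1) \<in> borel_measurable (walk N E v)" for n
    unfolding walk_def measurable_cong_sets[OF IT.PF.sets_lim refl]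
    by (rule avoiding_measurable) auto
  then show ?thesis
    unfolding expected_hitting_time_def hitting_time_conv_suminf
    by (subst nn_integral_suminf) (auto simp: nn_integral_avoiding_walk)
qed

section \<open>Hitting times on weighted graphs with a spectral gap\<close>

locale weighted_graph =
  fixes V :: "'a set" and a :: "'a \<Rightarrow> 'a \<Rightarrow> real"
  assumes finite_V: "finite V"
    and weight_sym: "a v w = a w v"
    and weight_nonneg: "0 \<le> a v w"
begin

definition deg :: "'a \<Rightarrow> real" where
  "deg v = (\<Sum>w\<in>V. a v w)"

definition avg :: "('a \<Rightarrow> real) \<Rightarrow> 'a \<Rightarrow> real" where
  "avg f v = (\<Sum>w\<in>V. a v w * f w) / deg v"

definition vol :: real where
  "vol = (\<Sum>v\<in>V. deg v)"

definition inner :: "('a \<Rightarrow> real) \<Rightarrow> ('a \<Rightarrow> real) \<Rightarrow> real" where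
  "inner f g = (\<Sum>v\<in>V. deg v * f v * g v)"

definition mean :: "('a \<Rightarrow> real) \<Rightarrow> real" where
  "mean f = inner (\<lambda>_. 1) f / vol"

text \<open>The Dirichlet form. Each unordered pair of distinct vertices occurs twice in the double
  sum, hence the factor 1/2.\<close>

definition energy :: "('a \<Rightarrow> real) \<Rightarrow> real" where
  "energy f = (\<Sum>v\<in>V. \<Sum>w\<in>V. a v w * (f v - f w)\<^sup>2) / 2"

lemma inner_commute: "inner f g = inner g f"
  by (simp add: inner_def mult_ac)

lemma inner_add_right: "inner f (\<lambda>v. g v + h v) = inner f g + inner f h"
  by (simp add: inner_def algebra_simps sum.distrib)

lemma inner_diff_right: "inner f (\<lambda>v. g v - h v) = inner f g - inner f h"
  by (simp add: inner_def algebra_simps sum_subtractf)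

lemma inner_cmult_right: "inner f (\<lambda>v. c * g v) = c * inner f g"
  by (simp add: inner_def algebra_simps sum_distrib_left)

lemma inner_cong: "(\<And>v. v \<in> V \<Longrightarrow> f v = f' v) \<Longrightarrow> (\<And>v. v \<in> V \<Longrightarrow> g v = g' v) \<Longrightarrow> inner f g = inner f' g'"
  by (simp add: inner_def)

lemma inner_one_one: "inner (\<lambda>_. 1) (\<lambda>_. 1) = vol"
  by (simp add: inner_def vol_def)

lemma avg_cong: "(\<And>v. v \<in> V \<Longrightarrow> f v = g v) \<Longrightarrow> avg f v = avg g v"
  by (simp add: avg_def)

lemma avg_add: "avg (\<lambda>v. f v + g v) v = avg f v + avg g v"
  by (simp add: avg_def algebra_simps sum.distrib add_divide_distrib)

lemma avg_diff: "avg (\<lambda>v. f v - g v) v = avg f v - avg g v"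
  by (simp add: avg_def algebra_simps sum_subtractf diff_divide_distrib)

lemma deg_nonneg: "0 \<le> deg v"
  by (simp add: deg_def sum_nonneg weight_nonneg)

lemma inner_nonneg: "(\<And>v. v \<in> V \<Longrightarrow> 0 \<le> f v) \<Longrightarrow> (\<And>v. v \<in> V \<Longrightarrow> 0 \<le> g v) \<Longrightarrow> 0 \<le> inner f g"
  by (simp add: inner_def sum_nonneg deg_nonneg)

lemma avg_mono: "(\<And>w. w \<in> V \<Longrightarrow> f w \<le> g w) \<Longrightarrow> avg f v \<le> avg g v"
  unfolding avg_def by (intro divide_right_mono sum_mono mult_left_mono weight_nonneg deg_nonneg) auto

lemma avg_nonneg: "(\<And>w. w \<in> V \<Longrightarrow> 0 \<le> f w) \<Longrightarrow> 0 \<le> avg f v"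
  unfolding avg_def by (intro divide_nonneg_nonneg sum_nonneg mult_nonneg_nonneg weight_nonneg deg_nonneg) auto

lemma energy_nonneg: "0 \<le> energy f"
  by (simp add: energy_def sum_nonneg weight_nonneg)

end

text \<open>\<open>poincare\<close> is the variational form of a spectral gap: on centred functions
  the eigenvalues of the identity minus \<open>avg\<close> are at least \<open>\<gamma>\<close>.
  Eigenvalues of \<open>avg\<close> near -1 are allowed.\<close>

locale spectral_gap_graph = weighted_graph +
  fixes \<gamma> :: real
  assumes nonempty: "V \<noteq> {}"
    and deg_pos: "v \<in> V \<Longrightarrow> 0 < deg v"
    and gap_pos: "0 < \<gamma>"
    and poincare: "\<gamma> * inner (\<lambda>v. f v - mean f) (\<lambda>v. f v - mean f) \<le> energy f"
begin

section \<open>Reversibility and the Dirichlet form\<close>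

lemma vol_pos: "0 < vol"
  unfolding vol_def by (rule sum_pos) (use finite_V nonempty deg_pos in auto)

lemma avg_const: "v \<in> V \<Longrightarrow> avg (\<lambda>_. c) v = c"
  using deg_pos[of v] by (simp add: avg_def deg_def flip: sum_distrib_right)

lemma inner_avg: "inner f (avg g) = (\<Sum>v\<in>V. \<Sum>w\<in>V. a v w * f v * g w)"
  unfolding inner_def
proof (rule sum.cong)
  fix v assume "v \<in> V"
  then have "deg v * f v * avg g v = f v * (\<Sum>w\<in>V. a v w * g w)"
    using deg_pos[of v] by (simp add: avg_def)
  then show "deg v * f v * avg g v = (\<Sum>w\<in>V. a v w * f v * g w)"
    by (simp add: sum_distrib_left mult_ac)
qed simp

text \<open>Reversibility of the walk: the bilinear form in \<open>inner_avg\<close> is symmetric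
  because \<open>a\<close> is.\<close>

lemma inner_avg_commute: "inner f (avg g) = inner (avg f) g"
proof -
  have "inner f (avg g) = (\<Sum>w\<in>V. \<Sum>v\<in>V. a w v * g w * f v)"
    unfolding inner_avg by (subst sum.swap) (simp add: weight_sym mult_ac)
  also have "\<dots> = inner g (avg f)" by (rule inner_avg[symmetric])
  finally show ?thesis by (simp only: inner_commute)
qed

lemma inner_one_avg: "inner (\<lambda>_. 1) (avg f) = inner (\<lambda>_. 1) f"
  unfolding inner_avg_commute by (rule inner_cong) (auto simp: avg_const)

text \<open>Summation by parts: in the expanded square, both pure terms give
  \<open>inner f f\<close> and the mixed term gives \<open>inner f (avg f)\<close>.\<close>

lemma energy_eq: "energy f = inner f (\<lambda>v. f v - avg f v)"
proof -
  have 1: "(\<Sum>v\<in>V. \<Sum>w\<in>V. a v w * (f v)\<^sup>2) = inner f f"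
    by (simp add: inner_def deg_def power2_eq_square mult.assoc flip: sum_distrib_right)
  have 2: "(\<Sum>v\<in>V. \<Sum>w\<in>V. a v w * (f w)\<^sup>2) = inner f f"
    unfolding 1[symmetric] by (subst sum.swap) (simp add: weight_sym)
  have "2 * energy f = (\<Sum>v\<in>V. \<Sum>w\<in>V. a v w * (f v)\<^sup>2 + a v w * (f w)\<^sup>2 - 2 * (a v w * f v * f w))"
    by (simp add: energy_def power2_eq_square algebra_simps)
  also have "\<dots> = inner f f + inner f f - 2 * inner f (avg f)"
    unfolding inner_avg by (simp add: sum.distrib sum_subtractf 1 2 flip: sum_distrib_left)
  finally show ?thesis by (simp add: inner_diff_right)
qed

lemma poincare_centred: "mean f = 0 \<Longrightarrow> \<gamma> * inner f f \<le> energy f"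
  using poincare[of f] by simp

text \<open>A harmonic function has energy 0, so the gap forces its variance to vanish; positive
  degrees make this a pointwise statement.\<close>

lemma harmonic_const:
  assumes "\<And>v. v \<in> V \<Longrightarrow> avg f v = f v" "v \<in> V"
  shows "f v = mean f"
proof -
  have "energy f = inner f (\<lambda>_. 0)"
    unfolding energy_eq by (rule inner_cong) (auto simp: assms)
  also have "\<dots> = 0" by (simp add: inner_def)
  finally have "\<gamma> * inner (\<lambda>v. f v - mean f) (\<lambda>v. f v - mean f) \<le> 0"
    using poincare[of f] by simp
  then have "inner (\<lambda>v. f v - mean f) (\<lambda>v. f v - mean f) \<le> 0"
    using gap_pos by (simp add: mult_le_0_iff)
  moreover have "deg v * (f v - mean f) * (f v - mean f) \<le> inner (\<lambda>v. f v - mean f) (\<lambda>v. f v - mean f)"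
    unfolding inner_def
    by (rule member_le_sum) (use assms finite_V in \<open>auto simp: deg_nonneg mult.assoc\<close>)
  ultimately have "deg v * (f v - mean f)\<^sup>2 \<le> 0"
    by (simp add: power2_eq_square mult.assoc)
  then show ?thesis
    using deg_pos[OF \<open>v \<in> V\<close>] by (simp add: mult_le_0_iff)
qed

text \<open>
  \<open>G = \<psi> + P\<psi> + P\<^sup>2G\<close>, where \<open>P\<close> is self-adjoint and \<open>P\<psi>\<close> is small; the gap controls the last term.
\<close>

lemma green_function_bounds:
  fixes G :: "'a \<Rightarrow> real" and w :: 'a
  assumes w: "w \<in> V"
    and G: "\<And>v. v \<in> V \<Longrightarrow> G v - avg G v = (if v = w then vol / deg w else 0) - 1"
    and centred: "mean G = 0"
    and le1: "\<And>v w. a v w \<le> 1"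
    and dmin: "0 < dmin" "\<And>v. v \<in> V \<Longrightarrow> dmin \<le> deg v"
  shows "vol / deg w - 2 \<le> G w" "G w \<le> vol / deg w * (1 + 1 / dmin + 1 / (\<gamma> * dmin))"
proof -
  define \<psi> where "\<psi> v = (if v = w then vol / deg w else 0) - 1" for v
  define \<phi> where "\<phi> = avg \<psi>"
  define F where "F = avg G"
  have dw: "0 < deg w" using deg_pos w by simp
  \<comment> \<open>Pairing with \<open>\<psi>\<close> evaluates a centred function at
    \<open>w\<close>, up to the factor \<open>vol\<close>.\<close>
  have inner_\<psi>: "inner \<psi> f = vol * f w - inner (\<lambda>_. 1) f" for f
  proof -
    have "inner \<psi> f = (\<Sum>v\<in>V. (if v = w then vol * f w else 0) - deg v * f v)"
      unfolding inner_def \<psi>_def using dw by (intro sum.cong) (auto simp: algebra_simps)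
    also have "\<dots> = vol * f w - inner (\<lambda>_. 1) f"
      using w finite_V by (simp add: sum_subtractf inner_def)
    finally show ?thesis .
  qed
  have \<psi>0: "inner (\<lambda>_. 1) \<psi> = 0"
    unfolding inner_commute[of _ \<psi>] inner_\<psi> inner_one_one by simp
  have \<phi>0: "inner (\<lambda>_. 1) \<phi> = 0"
    unfolding \<phi>_def inner_one_avg by (rule \<psi>0)
  have G0: "inner (\<lambda>_. 1) G = 0"
    using centred vol_pos by (simp add: mean_def)
  have F0: "mean F = 0"
    unfolding F_def mean_def inner_one_avg by (simp add: G0)
  have \<phi>: "\<phi> v = vol / deg w * (a v w / deg v) - 1" if "v \<in> V" for v
  proof -
    have "(\<Sum>u\<in>V. a v u * \<psi> u) = (\<Sum>u\<in>V. (if u = w then a v w * (vol / deg w) else 0) - a v u)"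
      unfolding \<psi>_def by (intro sum.cong) (auto simp: algebra_simps)
    also have "\<dots> = a v w * (vol / deg w) - deg v"
      using w finite_V by (simp add: sum_subtractf deg_def)
    finally show ?thesis
      using deg_pos[OF that] by (simp add: \<phi>_def avg_def field_simps)
  qed
  have GF: "G v = \<psi> v + F v" if "v \<in> V" for v
    using G[OF that] by (simp add: \<psi>_def F_def)
  have F\<phi>: "F v = \<phi> v + avg F v" for v
  proof -
    have "F v = avg (\<lambda>v. \<psi> v + F v) v" by (subst F_def) (rule avg_cong[OF GF])
    then show ?thesis by (simp add: avg_add \<phi>_def)
  qed
  \<comment> \<open>By \<open>F\<phi>\<close> the function \<open>F\<close> minus its average is
    \<open>\<phi>\<close>, so the remainder of the expansion is an energy.\<close>
  have energy_F: "energy F = inner \<phi> F"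
    unfolding energy_eq inner_commute[of \<phi>] by (rule inner_cong) (use F\<phi> in \<open>auto simp: algebra_simps\<close>)

  \<comment> \<open>Inserting \<open>GF\<close>, then \<open>F\<phi>\<close>, and moving
    \<open>avg\<close> to the other side leaves two explicit terms and the remainder
    \<open>inner \<phi> F\<close>.\<close>
  have "vol * G w = inner \<psi> G" by (simp add: inner_\<psi> G0)
  also have "\<dots> = inner \<psi> (\<lambda>v. \<psi> v + F v)" by (rule inner_cong) (auto simp: GF)
  also have "\<dots> = inner \<psi> \<psi> + inner \<psi> F" by (rule inner_add_right)
  also have "inner \<psi> F = inner \<psi> (\<lambda>v. \<phi> v + avg F v)" by (rule inner_cong) (use F\<phi> in auto)
  also have "\<dots> = inner \<psi> \<phi> + inner \<phi> F" by (simp add: inner_add_right inner_avg_commute \<phi>_def)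
  finally have main: "vol * G w = vol * (vol / deg w - 1) + vol * (vol / deg w * (a w w / deg w) - 1) + inner \<phi> F"
    unfolding inner_\<psi>[of \<psi>] inner_\<psi>[of \<phi>] \<psi>0 \<phi>0 \<phi>[OF w] by (simp add: \<psi>_def)

  \<comment> \<open>Lower bound: the remainder and the loop term are dropped. The two summands -1 in
    \<open>main\<close> make up the -2.\<close>
  have "0 \<le> inner \<phi> F" using energy_nonneg[of F] energy_F by simp
  moreover have "0 \<le> vol * (vol / deg w * (a w w / deg w))"
    using vol_pos dw weight_nonneg[of w w] by simp
  ultimately have "vol * (vol / deg w - 2) \<le> vol * G w"
    unfolding main by (simp add: algebra_simps)
  then show "vol / deg w - 2 \<le> G w"
    by (simp only: mult_le_cancel_left_pos[OF vol_pos])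

  \<comment> \<open>In the expanded square the mixed term sums to \<open>- 2 * vol\<close> and
    outweighs the last term \<open>vol\<close>; what remains is small because weights are at most 1
    and degrees at least \<open>dmin\<close>.\<close>
  have "inner \<phi> \<phi> = (\<Sum>v\<in>V. (vol / deg w)\<^sup>2 * ((a v w)\<^sup>2 / deg v) - 2 * (vol / deg w) * a v w + deg v)"
    unfolding inner_def
  proof (rule sum.cong)
    fix v assume v: "v \<in> V"
    have "deg v * (y * (x / deg v) - 1) * (y * (x / deg v) - 1) = y\<^sup>2 * (x\<^sup>2 / deg v) - 2 * y * x + deg v" for x y
      using deg_pos[OF v] by (simp add: field_simps power2_eq_square)
    then show "deg v * \<phi> v * \<phi> v = (vol / deg w)\<^sup>2 * ((a v w)\<^sup>2 / deg v) - 2 * (vol / deg w) * a v w + deg v"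
      unfolding \<phi>[OF v] .
  qed simp
  also have "\<dots> = (vol / deg w)\<^sup>2 * (\<Sum>v\<in>V. (a v w)\<^sup>2 / deg v) - 2 * (vol / deg w) * deg w + vol"
    by (simp add: sum.distrib sum_subtractf sum_distrib_left deg_def vol_def weight_sym[of w])
  also have "\<dots> \<le> (vol / deg w)\<^sup>2 * (\<Sum>v\<in>V. (a v w)\<^sup>2 / deg v)"
    using dw vol_pos by simp
  also have "(\<Sum>v\<in>V. (a v w)\<^sup>2 / deg v) \<le> (\<Sum>v\<in>V. a v w / dmin)"
  proof (rule sum_mono)
    fix v assume v: "v \<in> V"
    have "(a v w)\<^sup>2 \<le> a v w"
      using le1[of v w] weight_nonneg[of v w] by (simp add: power2_eq_square mult_left_le)
    then show "(a v w)\<^sup>2 / deg v \<le> a v w / dmin"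
      by (intro frac_le weight_nonneg dmin v)
  qed
  also have "(\<Sum>v\<in>V. a v w / dmin) = deg w / dmin"
    by (simp add: deg_def weight_sym[of w] flip: sum_divide_distrib)
  finally have "inner \<phi> \<phi> \<le> (vol / deg w)\<^sup>2 * (deg w / dmin)"
    by (simp add: mult_left_mono)
  then have \<phi>\<phi>: "inner \<phi> \<phi> \<le> vol\<^sup>2 / (deg w * dmin)"
    using dw by (simp add: power2_eq_square)

  \<comment> \<open>Upper bound: Young's inequality with parameter \<open>\<gamma>\<close>. The gap
    bounds \<open>\<gamma> * inner F F\<close> by \<open>energy F\<close>, which is
    \<open>inner \<phi> F\<close> again and is absorbed on the left.\<close>
  have "2 * inner \<phi> F = (\<Sum>v\<in>V. 2 * (deg v * \<phi> v * F v))" by (simp add: inner_def sum_distrib_left)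
  also have "\<dots> \<le> (\<Sum>v\<in>V. \<gamma> * (deg v * F v * F v) + deg v * \<phi> v * \<phi> v / \<gamma>)"
  proof (rule sum_mono)
    fix v assume v: "v \<in> V"
    have "0 \<le> (\<gamma> * F v - \<phi> v)\<^sup>2 / \<gamma>" using gap_pos by simp
    also have "\<dots> = \<gamma> * (F v * F v) + \<phi> v * \<phi> v / \<gamma> - 2 * (\<phi> v * F v)"
      using gap_pos by (simp add: field_simps power2_eq_square)
    finally have "deg v * (2 * (\<phi> v * F v)) \<le> deg v * (\<gamma> * (F v * F v) + \<phi> v * \<phi> v / \<gamma>)"
      by (intro mult_left_mono deg_nonneg) simp
    then show "2 * (deg v * \<phi> v * F v) \<le> \<gamma> * (deg v * F v * F v) + deg v * \<phi> v * \<phi> v / \<gamma>"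
      by (simp add: algebra_simps)
  qed
  also have "\<dots> = \<gamma> * inner F F + inner \<phi> \<phi> / \<gamma>"
    by (simp add: inner_def sum.distrib sum_distrib_left sum_divide_distrib)
  also have "\<gamma> * inner F F \<le> inner \<phi> F"
    using poincare_centred[OF F0] energy_F by simp
  finally have "inner \<phi> F \<le> inner \<phi> \<phi> / \<gamma>" by simp
  also have "\<dots> \<le> vol\<^sup>2 / (deg w * dmin) / \<gamma>"
    using \<phi>\<phi> gap_pos by (intro divide_right_mono) auto
  finally have "inner \<phi> F \<le> vol * (vol / deg w * (1 / (\<gamma> * dmin)))"
    by (simp add: power2_eq_square mult_ac)
  moreover have "a w w / deg w \<le> 1 / dmin"
    by (rule frac_le) (use le1 dmin w in auto)
  then have "vol * (vol / deg w * (a w w / deg w)) \<le> vol * (vol / deg w * (1 / dmin))"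
    using vol_pos dw by (intro mult_left_mono) auto
  ultimately have "vol * G w \<le> vol * (vol / deg w * (1 + 1 / dmin + 1 / (\<gamma> * dmin)))"
    unfolding main using vol_pos by (simp add: algebra_simps)
  then show "G w \<le> vol / deg w * (1 + 1 / dmin + 1 / (\<gamma> * dmin))"
    by (simp only: mult_le_cancel_left_pos[OF vol_pos])
qed

section \<open>From the Poisson equation to mean hitting times\<close>

text \<open>Kac's formula for the return time, less the first step. The integral of
  \<open>h - avg h\<close> against the invariant weights is 0, and its values off \<open>w\<close>
  are all 1, so the value at \<open>w\<close> is determined.\<close>

lemma avg_at_target:
  assumes w: "w \<in> V" and h0: "h w = 0" and h: "\<And>v. v \<in> V \<Longrightarrow> v \<noteq> w \<Longrightarrow> h v = 1 + avg h v"
  shows "avg h w = vol / deg w - 1"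
proof -
  have "inner (\<lambda>_. 1) (\<lambda>v. h v - avg h v) = 0"
    by (simp add: inner_diff_right inner_one_avg)
  moreover have "inner (\<lambda>_. 1) (\<lambda>v. h v - avg h v) = (\<Sum>v\<in>V. deg v - (if v = w then deg w * (1 + avg h w) else 0))"
    unfolding inner_def by (rule sum.cong) (use h h0 in \<open>auto simp: algebra_simps\<close>)
  ultimately have "vol = deg w * (1 + avg h w)"
    using w finite_V by (simp add: sum_subtractf vol_def)
  then show ?thesis
    using deg_pos[OF w] by (simp add: field_simps)
qed

text \<open>The function \<open>mean h - h\<close> is centred, solves the equation of
  \<open>green_function_bounds\<close>, and has the value \<open>mean h\<close> at
  \<open>w\<close>.\<close>

lemma mean_hitting_bounds:
  assumes w: "w \<in> V" and h0: "h w = 0" and h: "\<And>v. v \<in> V \<Longrightarrow> v \<noteq> w \<Longrightarrow> h v = 1 + avg h v"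
    and le1: "\<And>v w. a v w \<le> 1"
    and dmin: "0 < dmin" "\<And>v. v \<in> V \<Longrightarrow> dmin \<le> deg v"
  shows "vol / deg w - 2 \<le> mean h" "mean h \<le> vol / deg w * (1 + 1 / dmin + 1 / (\<gamma> * dmin))"
proof -
  let ?G = "\<lambda>v. mean h - h v"
  have eq: "?G v - avg ?G v = (if v = w then vol / deg w else 0) - 1" if "v \<in> V" for v
    using h[OF that] h0 avg_at_target[OF w h0 h] that by (auto simp: avg_diff avg_const)
  have "inner (\<lambda>_. 1) ?G = mean h * vol - inner (\<lambda>_. 1) h"
    using inner_cmult_right[of "\<lambda>_. 1" "mean h" "\<lambda>_. 1"]
    by (simp add: inner_diff_right inner_one_one)
  then have "mean ?G = 0"
    using vol_pos by (simp add: mean_def)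
  from green_function_bounds[OF w eq this le1 dmin]
  show "vol / deg w - 2 \<le> mean h" "mean h \<le> vol / deg w * (1 + 1 / dmin + 1 / (\<gamma> * dmin))"
    by (simp_all add: h0)
qed

text \<open>The random target lemma: \<open>v \<mapsto> \<Sum>w. \<pi>\<^sub>w h\<^sub>w(v)\<close> is harmonic, hence constant.\<close>

lemma random_target_bounds:
  assumes h0: "\<And>w. w \<in> V \<Longrightarrow> h w w = 0"
    and h: "\<And>v w. v \<in> V \<Longrightarrow> w \<in> V \<Longrightarrow> v \<noteq> w \<Longrightarrow> h w v = 1 + avg (h w) v"
    and le1: "\<And>v w. a v w \<le> 1"
    and dmin: "0 < dmin" "\<And>v. v \<in> V \<Longrightarrow> dmin \<le> deg v"
    and v: "v \<in> V"
  shows "real (card V) - 2 \<le> (\<Sum>w\<in>V. deg w / vol * h w v)"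
    and "(\<Sum>w\<in>V. deg w / vol * h w v) \<le> real (card V) * (1 + 1 / dmin + 1 / (\<gamma> * dmin))"
proof -
  define T where "T v = (\<Sum>w\<in>V. deg w / vol * h w v)" for v
  have avg_T: "avg T u = (\<Sum>w\<in>V. deg w / vol * avg (h w) u)" for u
  proof -
    have "(\<Sum>x\<in>V. a u x * T x) = (\<Sum>w\<in>V. \<Sum>x\<in>V. a u x * (deg w / vol * h w x))"
      unfolding T_def sum_distrib_left by (rule sum.swap)
    also have "\<dots> = (\<Sum>w\<in>V. deg w / vol * (\<Sum>x\<in>V. a u x * h w x))"
      by (simp add: sum_distrib_left mult_ac)
    finally show ?thesis
      unfolding avg_def times_divide_eq_right sum_divide_distrib[symmetric] by simp
  qed
  have "avg T u = T u" if u: "u \<in> V" for u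
  proof -
    \<comment> \<open>Each \<open>w\<close> other than \<open>u\<close> contributes
      \<open>deg w / vol\<close>; by \<open>avg_at_target\<close>, \<open>w = u\<close> contributes
      \<open>deg u / vol - 1\<close>. The weights sum to 1, so the total is 0.\<close>
    have "T u - avg T u = (\<Sum>w\<in>V. deg w / vol * (h w u - avg (h w) u))"
      unfolding T_def[of u] avg_T by (simp add: sum_subtractf algebra_simps)
    also have "\<dots> = (\<Sum>w\<in>V. deg w / vol - (if w = u then 1 else 0))"
    proof (rule sum.cong)
      fix w assume w: "w \<in> V"
      show "deg w / vol * (h w u - avg (h w) u) = deg w / vol - (if w = u then 1 else 0)"
      proof (cases "w = u")
        case True
        have "avg (h u) u = vol / deg u - 1"
          using avg_at_target[of u "h u"] u h0 h by simp
        then show ?thesis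
          using True h0[OF u] deg_pos[OF u] vol_pos by (simp add: field_simps)
      next
        case False
        then show ?thesis using h[OF u w] by simp
      qed
    qed simp
    also have "\<dots> = 0"
      using u finite_V vol_pos by (simp add: sum_subtractf flip: sum_divide_distrib vol_def)
    finally show ?thesis by simp
  qed
  then have Tv: "T v = mean T"
    by (rule harmonic_const) (use v in auto)
  have "inner (\<lambda>_. 1) T = (\<Sum>w\<in>V. deg w / vol * inner (\<lambda>_. 1) (h w))"
  proof -
    have "inner (\<lambda>_. 1) T = (\<Sum>u\<in>V. \<Sum>w\<in>V. deg w / vol * (deg u * h w u))"
      by (simp add: inner_def T_def sum_distrib_left mult_ac)
    then show ?thesis
      by (subst (asm) sum.swap) (simp add: inner_def sum_distrib_left)
  qed
  then have mean_T: "T v = (\<Sum>w\<in>V. deg w / vol * mean (h w))"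
    by (simp add: Tv mean_def sum_divide_distrib)
  note bounds = mean_hitting_bounds[OF _ h0 h le1 dmin]
  \<comment> \<open>The weight \<open>deg w / vol\<close> cancels the leading factor
    \<open>vol / deg w\<close> of both bounds, so every vertex contributes about 1, whatever its
    degree.\<close>
  have "real (card V) - 2 = (\<Sum>w\<in>V. 1 - 2 * (deg w / vol))"
    using vol_pos by (simp add: sum_subtractf flip: sum_divide_distrib sum_distrib_left vol_def)
  also have "\<dots> = (\<Sum>w\<in>V. deg w / vol * (vol / deg w - 2))"
  proof (rule sum.cong)
    fix w assume "w \<in> V"
    then show "1 - 2 * (deg w / vol) = deg w / vol * (vol / deg w - 2)"
      using deg_pos[of w] vol_pos by (simp add: field_simps)
  qed simp
  also have "\<dots> \<le> T v"
    unfolding mean_T using vol_pos by (intro sum_mono mult_left_mono bounds) (auto simp: deg_nonneg)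
  finally show "real (card V) - 2 \<le> (\<Sum>w\<in>V. deg w / vol * h w v)"
    by (simp add: T_def)
  have "T v \<le> (\<Sum>w\<in>V. deg w / vol * (vol / deg w * (1 + 1 / dmin + 1 / (\<gamma> * dmin))))"
    unfolding mean_T using vol_pos by (intro sum_mono mult_left_mono bounds) (auto simp: deg_nonneg)
  also have "\<dots> = (\<Sum>w\<in>V. 1 + 1 / dmin + 1 / (\<gamma> * dmin))"
  proof (rule sum.cong)
    fix w assume "w \<in> V"
    then show "deg w / vol * (vol / deg w * (1 + 1 / dmin + 1 / (\<gamma> * dmin))) = 1 + 1 / dmin + 1 / (\<gamma> * dmin)"
      using deg_pos[of w] vol_pos by simp
  qed simp
  finally show "(\<Sum>w\<in>V. deg w / vol * h w v) \<le> real (card V) * (1 + 1 / dmin + 1 / (\<gamma> * dmin))"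
    by (simp add: T_def)
qed

section \<open>Existence of finite hitting times by truncation\<close>

text \<open>The expected minimum of \<open>n\<close> and the hitting time of \<open>w\<close>, for
  the walk started in \<open>v\<close>.\<close>

primrec truncated_hitting :: "'a \<Rightarrow> nat \<Rightarrow> 'a \<Rightarrow> real" where
  "truncated_hitting w 0 v = 0"
| "truncated_hitting w (Suc n) v = (if v = w then 0 else 1 + avg (truncated_hitting w n) v)"

lemma truncated_hitting_target: "truncated_hitting w n w = 0"
  by (cases n) auto

lemma truncated_hitting_nonneg: "0 \<le> truncated_hitting w n v"
  by (induction n arbitrary: v) (auto intro!: add_nonneg_nonneg avg_nonneg)

lemma truncated_hitting_mono: "truncated_hitting w n v \<le> truncated_hitting w (Suc n) v"
proof (induction n arbitrary: v)
  case 0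
  then show ?case using truncated_hitting_nonneg[of w "Suc 0" v] by simp
next
  case (Suc n)
  then show ?case using avg_mono[of "truncated_hitting w n" "truncated_hitting w (Suc n)" v] by simp
qed

text \<open>
  The gap bounds the mean of \<open>f\<close> by means of its value \<open>0\<close> at the target, since
  \<open>\<gamma> deg w (mean f)\<^sup>2 \<le> energy f \<le> vol (mean f)\<close>.
\<close>

lemma truncated_hitting_bounded:
  assumes w: "w \<in> V" and v: "v \<in> V"
  shows "truncated_hitting w n v \<le> vol\<^sup>2 / (\<gamma> * deg w * deg v)"
proof -
  define f where "f = truncated_hitting w n"
  define m where "m = mean f"
  have fw: "f w = 0" by (simp add: f_def truncated_hitting_target)
  have f_nonneg: "0 \<le> f u" for u by (simp add: f_def truncated_hitting_nonneg)
  have dw: "0 < deg w" and dv: "0 < deg v" using deg_pos w v by auto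
  have S: "inner (\<lambda>_. 1) f = vol * m" using vol_pos by (simp add: m_def mean_def)
  have m0: "0 \<le> m" unfolding m_def mean_def
    using vol_pos by (intro divide_nonneg_pos inner_nonneg) (auto simp: f_nonneg)
  \<comment> \<open>Off the target, monotonicity in \<open>n\<close> and the recursion give
    \<open>f u \<le> 1 + avg f u\<close>; at the target \<open>f\<close> vanishes.\<close>
  have "f u * (f u - avg f u) \<le> f u * 1" if "u \<in> V" for u
  proof (cases "u = w")
    case True then show ?thesis by (simp add: fw)
  next
    case False
    then have "f u - avg f u \<le> 1"
      using truncated_hitting_mono[of w n u] by (simp add: f_def)
    then show ?thesis by (intro mult_left_mono f_nonneg)
  qed
  then have "energy f \<le> inner (\<lambda>_. 1) f"
    unfolding energy_eq inner_def
    by (intro sum_mono) (auto simp: mult.assoc intro!: mult_left_mono deg_nonneg)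
  also have "\<dots> = vol * m" by (rule S)
  finally have e: "energy f \<le> vol * m" .
  \<comment> \<open>Since \<open>f w = 0\<close>, the single summand at \<open>w\<close> of the
    variance is already \<open>deg w * m\<^sup>2\<close>.\<close>
  have "deg w * (f w - m) * (f w - m) \<le> inner (\<lambda>v. f v - m) (\<lambda>v. f v - m)"
    unfolding inner_def
    by (rule member_le_sum) (use w finite_V in \<open>auto simp: deg_nonneg mult.assoc\<close>)
  then have "\<gamma> * (deg w * m * m) \<le> vol * m"
    using poincare[of f] e gap_pos unfolding m_def[symmetric] fw
    by (smt (verit) mult_left_mono mult_minus_left mult_minus_right)
  then have "m * (\<gamma> * deg w * m) \<le> m * vol" by (simp add: mult_ac)
  then have "\<gamma> * deg w * m \<le> vol"
    using m0 vol_pos by (cases "m = 0") auto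
  then have m: "m \<le> vol / (\<gamma> * deg w)"
    using gap_pos dw by (simp add: field_simps)
  have "deg v * f v \<le> inner (\<lambda>_. 1) f"
    unfolding inner_def using member_le_sum[OF v, of "\<lambda>v. deg v * 1 * f v"] finite_V
    by (simp add: deg_nonneg f_nonneg)
  also have "\<dots> \<le> vol * (vol / (\<gamma> * deg w))"
    unfolding S using m vol_pos by (intro mult_left_mono) auto
  finally have "f v \<le> vol * (vol / (\<gamma> * deg w)) / deg v"
    by (simp only: pos_le_divide_eq[OF dv] mult.commute[of "f v"])
  then show ?thesis
    unfolding f_def by (simp add: power2_eq_square)
qed

text \<open>The limit is known to exist only for \<open>w\<close> and \<open>v\<close> in
  \<open>V\<close>, where the truncations are monotone and bounded.\<close>

definition hitting :: "'a \<Rightarrow> 'a \<Rightarrow> real" where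
  "hitting w v = lim (\<lambda>n. truncated_hitting w n v)"

lemma truncated_hitting_tendsto:
  assumes w: "w \<in> V" and v: "v \<in> V"
  shows "(\<lambda>n. truncated_hitting w n v) \<longlonglongrightarrow> hitting w v"
proof -
  have "convergent (\<lambda>n. truncated_hitting w n v)"
  proof (rule Bseq_mono_convergent)
    show "Bseq (\<lambda>n. truncated_hitting w n v)"
      using truncated_hitting_bounded[OF w v] truncated_hitting_nonneg
      by (intro BseqI'[of _ "vol\<^sup>2 / (\<gamma> * deg w * deg v)"]) simp
    show "\<forall>m n. m \<le> n \<longrightarrow> truncated_hitting w m v \<le> truncated_hitting w n v"
      using lift_Suc_mono_le[of "\<lambda>n. truncated_hitting w n v"] truncated_hitting_mono by blast
  qed
  then show ?thesis unfolding hitting_def by (simp add: convergent_LIMSEQ_iff)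
qed

lemma hitting_nonneg: "w \<in> V \<Longrightarrow> v \<in> V \<Longrightarrow> 0 \<le> hitting w v"
  by (rule LIMSEQ_le_const[OF truncated_hitting_tendsto]) (auto simp: truncated_hitting_nonneg)

lemma hitting_target: "w \<in> V \<Longrightarrow> hitting w w = 0"
  unfolding hitting_def by (simp add: truncated_hitting_target)

lemma hitting_step:
  assumes w: "w \<in> V" and v: "v \<in> V" and "v \<noteq> w"
  shows "hitting w v = 1 + avg (hitting w) v"
proof -
  have "(\<lambda>n. 1 + avg (truncated_hitting w n) v) \<longlonglongrightarrow> 1 + avg (hitting w) v"
    unfolding avg_def divide_inverse by (intro tendsto_intros truncated_hitting_tendsto w)
  moreover have "(\<lambda>n. truncated_hitting w (Suc n) v) \<longlonglongrightarrow> hitting w v"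
    by (rule LIMSEQ_Suc) (rule truncated_hitting_tendsto[OF w v])
  ultimately show ?thesis
    using \<open>v \<noteq> w\<close> by (simp add: LIMSEQ_unique)
qed

end

section \<open>Cheeger's inequality\<close>

text \<open>
  Co-area argument: lowering the largest value of \<open>f\<close> to the second largest one changes the sum by
  a nonnegative multiple of a cut. The kernel is signed in the application: \<open>b = a - c/N\<close>.
\<close>

lemma sum_abs_diff_nonneg_of_cuts:
  fixes b :: "'a \<Rightarrow> 'a \<Rightarrow> real" and f :: "'a \<Rightarrow> real"
  assumes "finite V" and sym: "\<And>v w. b v w = b w v"
    and cut: "\<And>S. S \<subseteq> V \<Longrightarrow> 0 \<le> (\<Sum>v\<in>S. \<Sum>w\<in>V - S. b v w)"
  shows "0 \<le> (\<Sum>v\<in>V. \<Sum>w\<in>V. b v w * \<bar>f v - f w\<bar>)"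
proof (induction "card (f ` V)" arbitrary: f rule: less_induct)
  case less
  show ?case
  proof (cases "\<exists>x. f ` V \<subseteq> {x}")
    case True
    then obtain x where "f ` V \<subseteq> {x}" ..
    then have "f v = x" if "v \<in> V" for v using that by auto
    then show ?thesis by simp
  next
    case False
    define t where "t = Max (f ` V)"
    define s where "s = Max (f ` V - {t})"
    define S where "S = {v \<in> V. f v = t}"
    define f' where "f' v = min (f v) s" for v
    have fin: "finite (f ` V)" "finite (f ` V - {t})" using \<open>finite V\<close> by auto
    have ne: "f ` V - {t} \<noteq> {}" using False by blast
    have t: "t \<in> f ` V" unfolding t_def using fin ne by (intro Max_in) auto
    have s: "s \<in> f ` V - {t}" unfolding s_def using fin ne by (intro Max_in) auto
    have le_t: "f v \<le> t" if "v \<in> V" for v unfolding t_def using fin that by auto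
    have le_s: "f v \<le> s" if "v \<in> V" "v \<notin> S" for v
      unfolding s_def using fin that by (intro Max_ge) (auto simp: S_def)
    have st: "s < t" using s le_t by fastforce
    have f'S: "f' v = s" if "v \<in> S" for v using that st by (simp add: f'_def S_def)
    have f'nS: "f' v = f v" if "v \<in> V" "v \<notin> S" for v using le_s[OF that] by (simp add: f'_def)
    have "f' ` V \<subseteq> f ` V - {t}"
    proof (rule image_subsetI)
      fix v assume v: "v \<in> V"
      have "f' v \<in> f ` V" using s f'S f'nS v by (cases "v \<in> S") auto
      moreover have "f' v \<noteq> t" using st by (simp add: f'_def)
      ultimately show "f' v \<in> f ` V - {t}" by simp
    qed
    then have "f' ` V \<subset> f ` V" using t by blast
    then have IH: "0 \<le> (\<Sum>v\<in>V. \<Sum>w\<in>V. b v w * \<bar>f' v - f' w\<bar>)"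
      by (rule less[OF psubset_card_mono[OF fin(1)]])
    have split: "\<bar>f v - f w\<bar> = \<bar>f' v - f' w\<bar> +
        (t - s) * (of_bool (v \<in> S \<and> w \<notin> S) + of_bool (w \<in> S \<and> v \<notin> S))" if "v \<in> V" "w \<in> V" for v w
      using that f'S[of v] f'S[of w] f'nS[of v] f'nS[of w] le_s[of v] le_s[of w] st
      by (cases "v \<in> S"; cases "w \<in> S") (simp_all add: S_def)
    have cutS: "(\<Sum>v\<in>V. \<Sum>w\<in>V. b v w * of_bool (v \<in> S \<and> w \<notin> S)) = (\<Sum>v\<in>S. \<Sum>w\<in>V - S. b v w)"
    proof -
      have "(\<Sum>v\<in>V. \<Sum>w\<in>V. b v w * of_bool (v \<in> S \<and> w \<notin> S)) =
          (\<Sum>v\<in>S. \<Sum>w\<in>V. b v w * of_bool (v \<in> S \<and> w \<notin> S))"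
        using \<open>finite V\<close> by (intro sum.mono_neutral_right) (auto simp: S_def)
      also have "\<dots> = (\<Sum>v\<in>S. \<Sum>w\<in>V - S. b v w)"
        using \<open>finite V\<close> by (intro sum.cong refl sum.mono_neutral_cong_right) auto
      finally show ?thesis .
    qed
    \<comment> \<open>By symmetry both orientations of a crossing pair give the same sum, so the
      change is \<open>2 * (t - s)\<close> times the cut of \<open>S\<close>.\<close>
    moreover have "(\<Sum>v\<in>V. \<Sum>w\<in>V. b v w * of_bool (w \<in> S \<and> v \<notin> S)) =
        (\<Sum>v\<in>V. \<Sum>w\<in>V. b v w * of_bool (v \<in> S \<and> w \<notin> S))"
      by (subst sum.swap) (simp add: sym)
    ultimately have "(\<Sum>v\<in>V. \<Sum>w\<in>V. b v w * (of_bool (v \<in> S \<and> w \<notin> S) + of_bool (w \<in> S \<and> v \<notin> S))) =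
        2 * (\<Sum>v\<in>S. \<Sum>w\<in>V - S. b v w)"
      by (simp only: distrib_left sum.distrib)
    moreover have "(\<Sum>v\<in>V. \<Sum>w\<in>V. b v w * \<bar>f v - f w\<bar>) =
       (\<Sum>v\<in>V. \<Sum>w\<in>V. b v w * \<bar>f' v - f' w\<bar>) +
       (t - s) * (\<Sum>v\<in>V. \<Sum>w\<in>V. b v w * (of_bool (v \<in> S \<and> w \<notin> S) + of_bool (w \<in> S \<and> v \<notin> S)))"
      unfolding sum_distrib_left sum.distrib[symmetric]
      by (intro sum.cong refl) (simp only: split distrib_left mult.left_commute)
    moreover have "0 \<le> (\<Sum>v\<in>S. \<Sum>w\<in>V - S. b v w)"
      by (rule cut) (auto simp: S_def)
    ultimately show ?thesis
      using IH st by simp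
  qed
qed

text \<open>Take the least value of \<open>f\<close> with at most half of the vertices strictly
  above it. If more than half were strictly below, the largest value below would qualify
  too.\<close>

lemma ex_median:
  fixes f :: "'a \<Rightarrow> real"
  assumes "finite V" "V \<noteq> {}"
  obtains m where "2 * card {v \<in> V. m < f v} \<le> card V" "2 * card {v \<in> V. f v < m} \<le> card V"
proof -
  define X where "X = {x \<in> f ` V. 2 * card {v \<in> V. x < f v} \<le> card V}"
  have finX: "finite X" using assms by (simp add: X_def)
  have "Max (f ` V) \<in> X"
  proof -
    have none: "{v \<in> V. Max (f ` V) < f v} = {}" using assms by (auto simp: not_less)
    show ?thesis unfolding X_def mem_Collect_eq none using assms by (intro conjI Max_in) auto
  qed
  then have "X \<noteq> {}" by auto
  define m where "m = Min X"
  have m: "m \<in> X" unfolding m_def using finX \<open>X \<noteq> {}\<close> by (rule Min_in)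
  have "2 * card {v \<in> V. f v < m} \<le> card V"
  proof (rule ccontr)
    assume large: "\<not> 2 * card {v \<in> V. f v < m} \<le> card V"
    define L where "L = {v \<in> V. f v < m}"
    have finL: "finite L" using assms by (simp add: L_def)
    have "L \<noteq> {}" using large unfolding L_def by (intro notI) simp
    define x where "x = Max (f ` L)"
    have x: "x \<in> f ` L" unfolding x_def using finL \<open>L \<noteq> {}\<close> by (intro Max_in) auto
    have "{v \<in> V. x < f v} \<subseteq> V - L"
    proof
      fix v assume v: "v \<in> {v \<in> V. x < f v}"
      have "v \<notin> L"
      proof
        assume "v \<in> L"
        then have "f v \<le> x" unfolding x_def using finL by auto
        with v show False by simp
      qed
      with v show "v \<in> V - L" by simp
    qed
    then have "card {v \<in> V. x < f v} \<le> card (V - L)"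
      using assms by (intro card_mono) auto
    also have "\<dots> = card V - card L"
      using finL by (intro card_Diff_subset) (auto simp: L_def)
    finally have "2 * card {v \<in> V. x < f v} \<le> card V"
      using large unfolding L_def by linarith
    then have "x \<in> X" using x by (auto simp: X_def L_def)
    then have "m \<le> x" unfolding m_def using finX by simp
    moreover have "x < m" using x by (auto simp: L_def)
    ultimately show False by simp
  qed
  with m show thesis by (intro that[of m]) (auto simp: X_def)
qed

context weighted_graph
begin

text \<open>The second moment about \<open>m\<close> is a quadratic polynomial in \<open>m\<close>
  with its minimum at the mean. This lets a median take the place of the mean.\<close>

lemma inner_mean_le:
  assumes "0 < vol"
  shows "inner (\<lambda>v. f v - mean f) (\<lambda>v. f v - mean f) \<le> inner (\<lambda>v. f v - m) (\<lambda>v. f v - m)"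
proof -
  have 1: "inner (\<lambda>v. f v - x) (\<lambda>v. f v - x) = inner f f - 2 * x * (vol * mean f) + x\<^sup>2 * vol" for x
  proof -
    have "inner (\<lambda>v. f v - x) (\<lambda>v. f v - x) = (\<Sum>v\<in>V. deg v * f v * f v - 2 * x * (deg v * 1 * f v) + x\<^sup>2 * deg v)"
      by (simp add: inner_def power2_eq_square algebra_simps)
    also have "\<dots> = inner f f - 2 * x * inner (\<lambda>_. 1) f + x\<^sup>2 * vol"
      by (simp only: sum.distrib sum_subtractf sum_distrib_left[symmetric] inner_def vol_def)
    finally show ?thesis using assms by (simp add: mean_def)
  qed
  have "inner (\<lambda>v. f v - m) (\<lambda>v. f v - m) - inner (\<lambda>v. f v - mean f) (\<lambda>v. f v - mean f) = vol * (m - mean f)\<^sup>2"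
    unfolding 1 by (simp add: power2_eq_square algebra_simps)
  also have "\<dots> \<ge> 0" using assms by simp
  finally show ?thesis by simp
qed

text \<open>Cheeger's inequality: the co-area bound is applied to \<open>g\<bar>g\<bar>\<close>, where \<open>g = f - m\<close> for a median \<open>m\<close> of \<open>f\<close>.\<close>

lemma median_energy_bound:
  fixes c \<Delta> :: real
  assumes "V \<noteq> {}" "0 < c" "0 < \<Delta>"
    and cut: "\<And>S. S \<subseteq> V \<Longrightarrow> c * card S * card (V - S) \<le> card V * (\<Sum>v\<in>S. \<Sum>w\<in>V - S. a v w)"
    and deg_le: "\<And>v. v \<in> V \<Longrightarrow> deg v \<le> \<Delta>"
  obtains m where "(\<Sum>v\<in>V. (f v - m)\<^sup>2) \<le> 32 * \<Delta> / c\<^sup>2 * energy f"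
proof -
  obtain m where m: "2 * card {v \<in> V. m < f v} \<le> card V" "2 * card {v \<in> V. f v < m} \<le> card V"
    using ex_median[OF finite_V \<open>V \<noteq> {}\<close>] .
  define n where "n = real (card V)"
  have n: "0 < n" using finite_V \<open>V \<noteq> {}\<close> by (simp add: n_def card_gt_0_iff)
  define g where "g v = f v - m" for v
  define F where "F v = g v * \<bar>g v\<bar>" for v
  define Q where "Q = (\<Sum>v\<in>V. (g v)\<^sup>2)"
  \<comment> \<open>With this \<open>t\<close>, the term \<open>2 / t * (\<Delta> * Q)\<close> at
    the end equals \<open>c / 4 * Q\<close>, half of the left side, and can be absorbed.\<close>
  define t where "t = 8 * \<Delta> / c"
  have t: "0 < t" using assms by (simp add: t_def)

  have "0 \<le> (\<Sum>v\<in>V. \<Sum>w\<in>V. (a v w - c / n) * \<bar>F v - F w\<bar>)"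
  proof (rule sum_abs_diff_nonneg_of_cuts[OF finite_V])
    fix S assume S: "S \<subseteq> V"
    have "(\<Sum>v\<in>S. \<Sum>w\<in>V - S. a v w - c / n) = (\<Sum>v\<in>S. \<Sum>w\<in>V - S. a v w) - c * card S * card (V - S) / n"
      by (simp add: sum_subtractf)
    also have "\<dots> \<ge> 0" using cut[OF S] n by (simp add: n_def field_simps)
    finally show "0 \<le> (\<Sum>v\<in>S. \<Sum>w\<in>V - S. a v w - c / n)" .
  qed (simp add: weight_sym)
  then have coarea: "c / n * (\<Sum>v\<in>V. \<Sum>w\<in>V. \<bar>F v - F w\<bar>) \<le> (\<Sum>v\<in>V. \<Sum>w\<in>V. a v w * \<bar>F v - F w\<bar>)"
    by (simp add: left_diff_distrib sum_subtractf sum_distrib_left)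

  \<comment> \<open>By the choice of the median, at least half of the vertices lie on the other side
    of \<open>m\<close> than \<open>v\<close> or at \<open>m\<close>. For these the signed squares
    do not cancel.\<close>
  have half: "n / 2 * (g v)\<^sup>2 \<le> (\<Sum>w\<in>V. \<bar>F v - F w\<bar>)" if "v \<in> V" for v
  proof -
    define A where "A = {w \<in> V. g v * g w \<le> 0}"
    have "n / 2 \<le> card A"
    proof -
      consider "g v > 0" | "g v < 0" | "g v = 0" by linarith
      then show ?thesis
      proof cases
        case 1
        then have "V = A \<union> {w \<in> V. m < f w}" by (auto simp: A_def g_def mult_le_0_iff)
        then have "card V \<le> card A + card {w \<in> V. m < f w}" by (metis card_Un_le)
        with m show ?thesis by (simp add: n_def)
      next
        case 2
        then have "V = A \<union> {w \<in> V. f w < m}" by (auto simp: A_def g_def mult_le_0_iff)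
        then have "card V \<le> card A + card {w \<in> V. f w < m}" by (metis card_Un_le)
        with m show ?thesis by (simp add: n_def)
      next
        case 3
        then have "A = V" by (auto simp: A_def)
        then show ?thesis by (simp add: n_def)
      qed
    qed
    then have "n / 2 * (g v)\<^sup>2 \<le> card A * (g v)\<^sup>2"
      by (intro mult_right_mono) auto
    also have "\<dots> = (\<Sum>w\<in>A. (g v)\<^sup>2)" by simp
    also have "\<dots> \<le> (\<Sum>w\<in>A. \<bar>F v - F w\<bar>)"
    proof (rule sum_mono)
      fix w assume "w \<in> A"
      then have "g v * g w \<le> 0" by (simp add: A_def)
      then consider "0 \<le> g v" "g w \<le> 0" | "g v \<le> 0" "0 \<le> g w"
        by (auto simp: mult_le_0_iff)
      then have "\<bar>F v - F w\<bar> = (g v)\<^sup>2 + (g w)\<^sup>2"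
      proof cases
        case 1
        then have "F v - F w = (g v)\<^sup>2 + (g w)\<^sup>2" by (simp add: F_def power2_eq_square)
        then show ?thesis by simp
      next
        case 2
        then have "F v - F w = - ((g v)\<^sup>2 + (g w)\<^sup>2)" by (simp add: F_def power2_eq_square)
        then show ?thesis by simp
      qed
      then show "(g v)\<^sup>2 \<le> \<bar>F v - F w\<bar>" by simp
    qed
    also have "\<dots> \<le> (\<Sum>w\<in>V. \<bar>F v - F w\<bar>)"
      using finite_V by (intro sum_mono2) (auto simp: A_def)
    finally show ?thesis .
  qed
  have "c / 2 * Q = c / n * (\<Sum>v\<in>V. n / 2 * (g v)\<^sup>2)"
    unfolding Q_def sum_distrib_left[symmetric] using n by simp
  also have "\<dots> \<le> c / n * (\<Sum>v\<in>V. \<Sum>w\<in>V. \<bar>F v - F w\<bar>)"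
    using \<open>0 < c\<close> n by (intro mult_left_mono sum_mono half) auto
  also note coarea
  also have "(\<Sum>v\<in>V. \<Sum>w\<in>V. a v w * \<bar>F v - F w\<bar>) \<le>
      (\<Sum>v\<in>V. \<Sum>w\<in>V. t / 2 * (a v w * (f v - f w)\<^sup>2) + 1 / t * (a v w * (g v)\<^sup>2) + 1 / t * (a v w * (g w)\<^sup>2))"
  proof (intro sum_mono)
    fix v w
    have diff: "\<bar>x * \<bar>x\<bar> - y * \<bar>y\<bar>\<bar> \<le> \<bar>x - y\<bar> * (\<bar>x\<bar> + \<bar>y\<bar>)" for x y :: real
    proof -
      \<comment> \<open>This symmetrised factorisation avoids a case distinction on the signs of
        \<open>x\<close> and \<open>y\<close>.\<close>
      have "2 * (x * \<bar>x\<bar> - y * \<bar>y\<bar>) = (x - y) * (\<bar>x\<bar> + \<bar>y\<bar>) + (x + y) * (\<bar>x\<bar> - \<bar>y\<bar>)"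
        by (simp add: algebra_simps)
      also have "\<bar>\<dots>\<bar> \<le> \<bar>x - y\<bar> * (\<bar>x\<bar> + \<bar>y\<bar>) + \<bar>x + y\<bar> * \<bar>\<bar>x\<bar> - \<bar>y\<bar>\<bar>"
        by (rule order_trans[OF abs_triangle_ineq]) (simp add: abs_mult)
      also have "\<bar>x + y\<bar> * \<bar>\<bar>x\<bar> - \<bar>y\<bar>\<bar> \<le> (\<bar>x\<bar> + \<bar>y\<bar>) * \<bar>x - y\<bar>"
        by (intro mult_mono) auto
      finally have "\<bar>2 * (x * \<bar>x\<bar> - y * \<bar>y\<bar>)\<bar> \<le> 2 * (\<bar>x - y\<bar> * (\<bar>x\<bar> + \<bar>y\<bar>))"
        by (simp add: mult.commute)
      then show ?thesis unfolding abs_mult[of 2] by simp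
    qed
    have "\<bar>x * \<bar>x\<bar> - y * \<bar>y\<bar>\<bar> \<le> t / 2 * (x - y)\<^sup>2 + 1 / t * x\<^sup>2 + 1 / t * y\<^sup>2" for x y :: real
    proof -
      \<comment> \<open>The first square gives Young's inequality with parameter \<open>t\<close>;
        the second accounts for \<open>(\<bar>x\<bar> + \<bar>y\<bar>)\<^sup>2 \<le> 2 * x\<^sup>2 +
        2 * y\<^sup>2\<close>.\<close>
      have "0 \<le> (t * \<bar>x - y\<bar> - (\<bar>x\<bar> + \<bar>y\<bar>))\<^sup>2 + (\<bar>x\<bar> - \<bar>y\<bar>)\<^sup>2"
        by simp
      also have "\<dots> = t\<^sup>2 * (x - y)\<^sup>2 - 2 * t * (\<bar>x - y\<bar> * (\<bar>x\<bar> + \<bar>y\<bar>)) + 2 * x\<^sup>2 + 2 * y\<^sup>2"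
        by (simp add: power2_diff power2_sum power_mult_distrib algebra_simps)
      finally have "\<bar>x - y\<bar> * (\<bar>x\<bar> + \<bar>y\<bar>) \<le> t / 2 * (x - y)\<^sup>2 + 1 / t * x\<^sup>2 + 1 / t * y\<^sup>2"
        using t by (simp add: field_simps power2_eq_square[of t])
      then show ?thesis using diff[of x y] by linarith
    qed
    from this[of "g v" "g w"] have "a v w * \<bar>F v - F w\<bar> \<le>
        a v w * (t / 2 * (f v - f w)\<^sup>2 + 1 / t * (g v)\<^sup>2 + 1 / t * (g w)\<^sup>2)"
      unfolding F_def by (intro mult_left_mono weight_nonneg) (simp add: g_def)
    then show "a v w * \<bar>F v - F w\<bar> \<le>
        t / 2 * (a v w * (f v - f w)\<^sup>2) + 1 / t * (a v w * (g v)\<^sup>2) + 1 / t * (a v w * (g w)\<^sup>2)"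
      by (simp only: distrib_left mult.left_commute)
  qed
  also have "\<dots> = t * energy f + 2 / t * (\<Sum>v\<in>V. deg v * (g v)\<^sup>2)"
  proof -
    have 1: "(\<Sum>v\<in>V. \<Sum>w\<in>V. a v w * (g v)\<^sup>2) = (\<Sum>v\<in>V. deg v * (g v)\<^sup>2)"
      by (simp add: deg_def flip: sum_distrib_right)
    have 2: "(\<Sum>v\<in>V. \<Sum>w\<in>V. a v w * (g w)\<^sup>2) = (\<Sum>v\<in>V. deg v * (g v)\<^sup>2)"
      unfolding 1[symmetric] by (subst sum.swap) (simp add: weight_sym)
    show ?thesis
      unfolding sum.distrib sum_distrib_left[symmetric] 1 2 energy_def by simp
  qed
  also have "\<dots> \<le> t * energy f + 2 / t * (\<Delta> * Q)"
    unfolding Q_def sum_distrib_left[of \<Delta>] using t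
    by (intro add_left_mono mult_left_mono sum_mono mult_right_mono deg_le) auto
  finally have "c / 2 * Q \<le> t * energy f + c / 4 * Q"
    using assms by (simp add: t_def)
  then have "Q \<le> 32 * \<Delta> / c\<^sup>2 * energy f"
    using assms by (simp add: t_def field_simps power2_eq_square)
  then show thesis by (intro that[of m]) (simp add: Q_def g_def)
qed

text \<open>The degree bound enters a second time when \<open>inner\<close> is compared with the
  unweighted sum in \<open>median_energy_bound\<close>; hence the square of
  \<open>\<Delta>\<close>.\<close>

lemma cheeger:
  fixes c \<Delta> :: real
  assumes "V \<noteq> {}" "0 < c" "0 < \<Delta>" "0 < vol"
    and cut: "\<And>S. S \<subseteq> V \<Longrightarrow> c * card S * card (V - S) \<le> card V * (\<Sum>v\<in>S. \<Sum>w\<in>V - S. a v w)"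
    and deg_le: "\<And>v. v \<in> V \<Longrightarrow> deg v \<le> \<Delta>"
  shows "c\<^sup>2 / (32 * \<Delta>\<^sup>2) * inner (\<lambda>v. f v - mean f) (\<lambda>v. f v - mean f) \<le> energy f"
proof -
  obtain m where m: "(\<Sum>v\<in>V. (f v - m)\<^sup>2) \<le> 32 * \<Delta> / c\<^sup>2 * energy f"
    using median_energy_bound[OF assms(1-3) cut deg_le] .
  have "inner (\<lambda>v. f v - mean f) (\<lambda>v. f v - mean f) \<le> inner (\<lambda>v. f v - m) (\<lambda>v. f v - m)"
    by (rule inner_mean_le) fact
  also have "\<dots> \<le> \<Delta> * (\<Sum>v\<in>V. (f v - m)\<^sup>2)"
    unfolding inner_def sum_distrib_left
    by (intro sum_mono) (simp add: mult.assoc power2_eq_square mult_right_mono deg_le)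
  also have "\<dots> \<le> \<Delta> * (32 * \<Delta> / c\<^sup>2 * energy f)"
    using m \<open>0 < \<Delta>\<close> by (intro mult_left_mono) auto
  finally show ?thesis
    using assms by (simp add: field_simps power2_eq_square)
qed

end

section \<open>Simple random walk on a graph\<close>

declare One_nat_def [simp del]

definition adj :: "nat set set \<Rightarrow> nat \<Rightarrow> nat \<Rightarrow> real" where
  "adj E v w = of_bool ({v, w} \<in> E)"

lemma weighted_graph_adj: "weighted_graph {1..N} (adj E)"
  by standard (auto simp: adj_def insert_commute)

lemma deg_adj: "weighted_graph.deg {1..N} (adj E) v = real (vertex_degree N E v)"
proof -
  interpret weighted_graph "{1..N}" "adj E" by (rule weighted_graph_adj)
  show ?thesis by (simp add: deg_def adj_def vertex_degree_def del: sum_of_bool_eq)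
qed

section \<open>Degree sum and connectedness\<close>

lemma card_ordered_pairs:
  assumes "e \<in> vertex_pairs N"
  shows "(\<Sum>v\<in>{1..N}. \<Sum>w\<in>{1..N}. of_bool ({v, w} = e)) = (if \<exists>v. e = {v} then 1 else 2 :: real)"
proof -
  obtain x y where e: "e = {x, y}" "x \<in> {1..N}" "y \<in> {1..N}"
    using assms by (auto simp: vertex_pairs_def)
  have "(\<Sum>v\<in>{1..N}. \<Sum>w\<in>{1..N}. of_bool ({v, w} = e)) =
      (\<Sum>z\<in>{1..N} \<times> {1..N}. of_bool ({fst z, snd z} = e) :: real)"
    by (simp add: sum.cartesian_product case_prod_unfold del: sum_of_bool_eq)
  also have "\<dots> = (\<Sum>z\<in>{(x, y), (y, x)}. 1)"
    using e by (intro sum.mono_neutral_cong_right) (auto simp: doubleton_eq_iff)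
  also have "\<dots> = (if \<exists>v. e = {v} then 1 else 2)"
    using e by (auto simp: doubleton_eq_iff)
  finally show ?thesis .
qed

text \<open>Double counting: an edge arises from two ordered pairs of end points, a loop from one.
  This identifies \<open>vol\<close> with the denominator of \<open>invariant_distr\<close>.\<close>

lemma sum_vertex_degree:
  assumes E: "E \<subseteq> vertex_pairs N" and "finite E"
  shows "(\<Sum>v\<in>{1..N}. real (vertex_degree N E v)) = 2 * real (card E) - real (card (loops E))"
proof -
  have "of_bool ({v, w} \<in> E) = (\<Sum>e\<in>E. of_bool ({v, w} = e) :: real)" for v w
    using \<open>finite E\<close> by (simp add: of_bool_def)
  then have "(\<Sum>v\<in>{1..N}. real (vertex_degree N E v)) = (\<Sum>v\<in>{1..N}. \<Sum>w\<in>{1..N}. \<Sum>e\<in>E. of_bool ({v, w} = e))"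
    by (simp only: vertex_degree_def of_nat_sum of_nat_of_bool)
  also have "\<dots> = (\<Sum>e\<in>E. \<Sum>v\<in>{1..N}. \<Sum>w\<in>{1..N}. of_bool ({v, w} = e))"
    by (subst sum.swap[of _ _ E], subst sum.swap[of _ _ E]) (rule refl)
  also have "\<dots> = (\<Sum>e\<in>E. 2 - of_bool (\<exists>v. e = {v}))"
    using E by (intro sum.cong refl) (subst card_ordered_pairs, auto)
  also have "\<dots> = 2 * real (card E) - real (card (loops E))"
    using \<open>finite E\<close> by (simp add: sum_subtractf loops_def Int_def)
  finally show ?thesis .
qed

text \<open>No edge leaves the set of vertices reachable from \<open>v\<close>, so its cut is 0 and
  its complement must be empty.\<close>

lemma connected_graph_of_cuts:
  fixes c :: real
  assumes "0 < c"
    and cut: "\<And>S. S \<subseteq> {1..N} \<Longrightarrow> c * card S * card ({1..N} - S) \<le> N * (\<Sum>v\<in>S. \<Sum>w\<in>{1..N} - S. adj E v w)"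
  shows "connected_graph N E"
  unfolding connected_graph_def
proof (intro ballI)
  fix v w assume vw: "v \<in> {1..N}" "w \<in> {1..N}"
  let ?R = "{(x, y). {x, y} \<in> E}\<^sup>*"
  define S where "S = {u \<in> {1..N}. (v, u) \<in> ?R}"
  have sub: "S \<subseteq> {1..N}" by (auto simp: S_def)
  have "adj E x y = 0" if "x \<in> S" "y \<in> {1..N} - S" for x y
  proof -
    have "{x, y} \<notin> E"
    proof
      assume "{x, y} \<in> E"
      with that have "(v, y) \<in> ?R" by (auto simp: S_def intro: rtrancl_into_rtrancl)
      with that show False by (auto simp: S_def)
    qed
    then show ?thesis by (simp add: adj_def)
  qed
  then have "c * card S * card ({1..N} - S) \<le> 0"
    using cut[OF sub] by simp
  moreover have "v \<in> S" using vw by (simp add: S_def)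
  moreover have "finite S" by (simp add: S_def)
  ultimately have "card ({1..N} - S) = 0"
    using \<open>0 < c\<close> by (auto simp: mult_le_0_iff card_eq_0_iff)
  then show "(v, w) \<in> ?R" using vw by (auto simp: S_def)
qed

section \<open>Probabilistic and analytic hitting times agree\<close>

lemma nn_integral_step_pmf:
  assumes "0 < vertex_degree N E x"
  shows "(\<integral>\<^sup>+y. ennreal (f y) \<partial>step_pmf N E x) =
    (\<Sum>y\<in>{1..N}. ennreal (of_bool ({x, y} \<in> E)) * ennreal (f y)) / ennreal (real (vertex_degree N E x))"
proof -
  have "neighbours N E x \<noteq> {}" "finite (neighbours N E x)"
    using assms unfolding vertex_degree_conv_card by (auto simp: card_gt_0_iff)
  then have "(\<integral>\<^sup>+y. ennreal (f y) \<partial>step_pmf N E x) = (\<Sum>y\<in>neighbours N E x. ennreal (f y)) / card (neighbours N E x)"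
    by (simp add: step_pmf_def nn_integral_pmf_of_set)
  also have "(\<Sum>y\<in>neighbours N E x. ennreal (f y)) = (\<Sum>y\<in>{1..N}. ennreal (of_bool ({x, y} \<in> E)) * ennreal (f y))"
    by (intro sum.mono_neutral_cong_left) (auto simp: neighbours_def)
  finally show ?thesis by (simp add: vertex_degree_conv_card ennreal_of_nat_eq_real_of_nat)
qed

text \<open>Partial sums of the tail-sum series satisfy the recursion of
  \<open>truncated_hitting\<close>, so the limits agree.\<close>

lemma expected_hitting_time_eq:
  assumes "spectral_gap_graph {1..N} (adj E) \<gamma>" "v \<in> {1..N}" "w \<in> {1..N}"
  shows "expected_hitting_time N E v w = ennreal (spectral_gap_graph.hitting {1..N} (adj E) w v)"
proof -
  interpret spectral_gap_graph "{1..N}" "adj E" \<gamma> by fact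
  let ?s = "\<lambda>k. (killed_step N E w ^^ k) (\<lambda>x. if x = w then 0 else 1)"
  have partial: "(\<Sum>k<n. ?s k x) = ennreal (truncated_hitting w n x)" if "x \<in> {1..N}" for n x
    using that
  proof (induction n arbitrary: x)
    case (Suc n)
    have d: "0 < vertex_degree N E x" using deg_pos[OF Suc.prems] by (simp add: deg_adj)
    have step: "(\<integral>\<^sup>+y. ennreal (f y) \<partial>step_pmf N E x) = ennreal (avg f x)" if "\<And>y. 0 \<le> f y" for f
      unfolding nn_integral_step_pmf[OF d] avg_def deg_adj adj_def using d that
      by (simp add: sum_nonneg divide_ennreal flip: ennreal_mult)
    have split: "(\<Sum>k<Suc n. ?s k x) = ?s 0 x + (\<Sum>k<n. killed_step N E w (?s k) x)"
      by (simp only: sum.lessThan_Suc_shift funpow.simps o_apply)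
    show ?case
    proof (cases "x = w")
      case True
      then show ?thesis unfolding split by (simp add: killed_step_def)
    next
      case False
      \<comment> \<open>The induction hypothesis covers only vertices in \<open>{1..N}\<close>, so
        it is applied almost everywhere for the step law.\<close>
      have "set_pmf (step_pmf N E x) \<subseteq> {1..N}"
        using d unfolding vertex_degree_conv_card
        by (auto simp: step_pmf_def card_gt_0_iff set_pmf_of_set) (auto simp: neighbours_def)
      then have "(\<Sum>k<n. killed_step N E w (?s k) x) = (\<integral>\<^sup>+y. ennreal (truncated_hitting w n y) \<partial>step_pmf N E x)"
        using False
        by (subst Suc.IH[symmetric, THEN nn_integral_cong_AE[OF AE_pmfI]])
           (auto simp: killed_step_def nn_integral_sum)
      also have "\<dots> = ennreal (avg (truncated_hitting w n) x)"
        by (rule step) (rule truncated_hitting_nonneg)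
      finally show ?thesis
        unfolding split using False
        by (simp add: avg_nonneg truncated_hitting_nonneg flip: ennreal_1 ennreal_plus)
    qed
  qed simp
  have "(\<lambda>n. \<Sum>k<n. ?s k v) \<longlonglongrightarrow> (\<Sum>k. ?s k v)"
    by (rule summable_LIMSEQ) auto
  moreover have "(\<lambda>n. \<Sum>k<n. ?s k v) \<longlonglongrightarrow> ennreal (hitting w v)"
    unfolding partial[OF assms(2)]
    by (intro tendsto_ennrealI truncated_hitting_tendsto assms)
  ultimately show ?thesis
    unfolding expected_hitting_time_conv_suminf by (rule LIMSEQ_unique)
qed

text \<open>The deterministic core: the cut hypothesis gives the gap
  \<open>c\<^sup>2 / (32 * \<Delta>\<^sup>2)\<close> by \<open>cheeger\<close>, and the random
  target bounds apply with it.\<close>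

lemma mean_hitting_time_bounds:
  fixes c \<Delta> dmin :: real
  assumes E: "E \<subseteq> vertex_pairs N" "finite E" and v: "v \<in> {1..N}"
    and pos: "0 < c" "0 < dmin" "0 < \<Delta>"
    and deg: "\<And>u. u \<in> {1..N} \<Longrightarrow> dmin \<le> vertex_degree N E u" "\<And>u. u \<in> {1..N} \<Longrightarrow> vertex_degree N E u \<le> \<Delta>"
    and cut: "\<And>S. S \<subseteq> {1..N} \<Longrightarrow> c * card S * card ({1..N} - S) \<le> N * (\<Sum>v\<in>S. \<Sum>w\<in>{1..N} - S. adj E v w)"
  obtains x where "mean_hitting_time N E v = ennreal x" "real N - 2 \<le> x"
    "x \<le> N * (1 + 1 / dmin + 32 * \<Delta>\<^sup>2 / (c\<^sup>2 * dmin))"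
proof -
  interpret weighted_graph "{1..N}" "adj E" by (rule weighted_graph_adj)
  have dpos: "0 < deg u" if "u \<in> {1..N}" for u
    using deg(1)[OF that] pos by (simp add: deg_adj)
  have "0 < vol"
    unfolding vol_def by (rule sum_pos) (use v dpos in auto)
  define \<gamma> where "\<gamma> = c\<^sup>2 / (32 * \<Delta>\<^sup>2)"
  have gap: "spectral_gap_graph {1..N} (adj E) \<gamma>"
  proof
    show "\<gamma> * inner (\<lambda>v. f v - mean f) (\<lambda>v. f v - mean f) \<le> energy f" for f
      unfolding \<gamma>_def
      by (rule cheeger) (use v pos deg(2) cut \<open>0 < vol\<close> in \<open>auto simp: deg_adj\<close>)
  qed (use v pos dpos in \<open>auto simp: \<gamma>_def\<close>)
  then interpret spectral_gap_graph "{1..N}" "adj E" \<gamma> .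
  define x where "x = (\<Sum>w\<in>{1..N}. deg w / vol * hitting w v)"
  have "vol = 2 * real (card E) - real (card (loops E))"
    unfolding vol_def deg_adj by (rule sum_vertex_degree[OF E])
  then have inv: "invariant_distr N E w = deg w / vol" for w
    by (simp add: invariant_distr_def deg_adj)
  have nonneg: "0 \<le> deg w / vol" for w
    using \<open>0 < vol\<close> by (simp add: deg_nonneg)
  have "mean_hitting_time N E v = (\<Sum>w\<in>{1..N}. ennreal (deg w / vol * hitting w v))"
    unfolding mean_hitting_time_def inv
    by (intro sum.cong refl) (simp only: expected_hitting_time_eq[OF gap v] ennreal_mult[OF nonneg hitting_nonneg[OF _ v]])
  also have "\<dots> = ennreal x"
    unfolding x_def by (rule sum_ennreal) (intro mult_nonneg_nonneg nonneg hitting_nonneg v)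
  finally have x: "mean_hitting_time N E v = ennreal x" .
  note bounds = random_target_bounds[of hitting dmin v, folded x_def]
  have "real N - 2 \<le> x" "x \<le> N * (1 + 1 / dmin + 1 / (\<gamma> * dmin))"
    using bounds hitting_target hitting_step pos deg(1) v by (auto simp: deg_adj adj_def)
  moreover have "1 / (\<gamma> * dmin) = 32 * \<Delta>\<^sup>2 / (c\<^sup>2 * dmin)" by (simp add: \<gamma>_def)
  ultimately show thesis using x that by metis
qed

section \<open>The stochastic block model\<close>

lemma finite_vertex_pairs: "finite (vertex_pairs N)"
  by (rule finite_subset[of _ "Pow {1..N}"]) (auto simp: vertex_pairs_def)

lemma edge_prob_bounds: "p \<in> {0..1} \<Longrightarrow> q \<in> {0..1} \<Longrightarrow> edge_prob M B p q e \<in> {0..1}"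
  by (simp add: edge_prob_def)

lemma prob_sbm:
  "measure_pmf.prob (sbm M N B p q) {E. Q E} =
     measure_pmf.prob (Pi_pmf (vertex_pairs N) False (\<lambda>e. bernoulli_pmf (edge_prob M B p q e)))
       {a. Q {e \<in> vertex_pairs N. a e}}"
  unfolding sbm_def by (subst measure_map_pmf) (simp add: vimage_def)

section \<open>Chernoff bounds for edge counts\<close>

text \<open>Independence factorises the expectation, and each factor is bounded by
  \<open>1 + y \<le> exp y\<close>.\<close>

lemma bernoulli_product_mgf:
  fixes P :: "'e \<Rightarrow> real"
  assumes "finite A" "J \<subseteq> A" and P: "\<And>e. e \<in> A \<Longrightarrow> P e \<in> {0..1}"
  defines "D \<equiv> measure_pmf (Pi_pmf A False (\<lambda>e. bernoulli_pmf (P e)))"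
  shows "integrable D (\<lambda>a. exp (t * (\<Sum>e\<in>J. of_bool (a e))))"
    and "(\<integral>a. exp (t * (\<Sum>e\<in>J. of_bool (a e))) \<partial>D) \<le> exp ((exp t - 1) * (\<Sum>e\<in>J. P e))"
proof -
  define f where "f e b = (if e \<in> J \<and> b then exp t else 1)" for e :: 'e and b
  have finJ: "finite J" using assms finite_subset by blast
  have eq: "exp (t * (\<Sum>e\<in>J. of_bool (a e))) = (\<Prod>e\<in>A. f e (a e))" for a
  proof -
    have "exp (t * (\<Sum>e\<in>J. of_bool (a e))) = (\<Prod>e\<in>J. exp (t * of_bool (a e)))"
      unfolding sum_distrib_left by (rule exp_sum[OF finJ])
    also have "\<dots> = (\<Prod>e\<in>A. f e (a e))"
      using assms by (intro prod.mono_neutral_cong_left) (auto simp: f_def)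
    finally show ?thesis .
  qed
  have int: "integrable (measure_pmf (bernoulli_pmf (P e))) (f e)" for e
    by (rule integrable_measure_pmf_finite) auto
  show "integrable D (\<lambda>a. exp (t * (\<Sum>e\<in>J. of_bool (a e))))"
    unfolding eq D_def by (intro integrable_prod_Pi_pmf int assms)
  have "(\<integral>a. exp (t * (\<Sum>e\<in>J. of_bool (a e))) \<partial>D) = (\<Prod>e\<in>A. \<integral>b. f e b \<partial>bernoulli_pmf (P e))"
    unfolding eq D_def by (intro expectation_prod_Pi_pmf int assms) (auto simp: f_def)
  also have "\<dots> = (\<Prod>e\<in>J. 1 + P e * (exp t - 1))"
    using assms by (intro prod.mono_neutral_cong_right) (auto simp: f_def algebra_simps)
  also have "\<dots> \<le> (\<Prod>e\<in>J. exp (P e * (exp t - 1)))"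
  proof (intro prod_mono conjI exp_ge_add_one_self)
    fix e assume "e \<in> J"
    then have "0 \<le> (1 - P e) + P e * exp t" using P[of e] assms by (intro add_nonneg_nonneg) auto
    then show "0 \<le> 1 + P e * (exp t - 1)" by (simp add: algebra_simps)
  qed
  also have "\<dots> = exp ((exp t - 1) * (\<Sum>e\<in>J. P e))"
    by (subst mult.commute) (simp only: sum_distrib_right exp_sum[OF finJ])
  finally show "(\<integral>a. exp (t * (\<Sum>e\<in>J. of_bool (a e))) \<partial>D) \<le> exp ((exp t - 1) * (\<Sum>e\<in>J. P e))" .
qed

text \<open>Markov's inequality for the exponential. The factor \<open>t\<close> inside the event
  covers both tails: a negative \<open>t\<close> reverses the inequality.\<close>

lemma bernoulli_product_chernoff:
  fixes P :: "'e \<Rightarrow> real"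
  assumes "finite A" "J \<subseteq> A" and P: "\<And>e. e \<in> A \<Longrightarrow> P e \<in> {0..1}"
  shows "measure_pmf.prob (Pi_pmf A False (\<lambda>e. bernoulli_pmf (P e)))
    {a. t * x \<le> t * (\<Sum>e\<in>J. of_bool (a e))} \<le> exp ((exp t - 1) * (\<Sum>e\<in>J. P e) - t * x)"
proof -
  let ?D = "measure_pmf (Pi_pmf A False (\<lambda>e. bernoulli_pmf (P e)))"
  let ?X = "\<lambda>a. exp (t * (\<Sum>e\<in>J. of_bool (a e)))"
  note mgf = bernoulli_product_mgf[OF assms, where t = t]
  have "measure_pmf.prob (Pi_pmf A False (\<lambda>e. bernoulli_pmf (P e))) {a. t * x \<le> t * (\<Sum>e\<in>J. of_bool (a e))} =
      measure ?D {a \<in> space ?D. exp (t * x) \<le> ?X a}"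
    by simp
  also have "\<dots> \<le> (\<integral>a. ?X a \<partial>?D) / exp (t * x)"
    by (rule integral_Markov_inequality_measure[where A = "{}"]) (use mgf in auto)
  also have "\<dots> \<le> exp ((exp t - 1) * (\<Sum>e\<in>J. P e)) / exp (t * x)"
    using mgf by (intro divide_right_mono) auto
  finally show ?thesis by (simp add: exp_diff)
qed

text \<open>The injection \<open>\<phi>\<close> serves to count edges by a second end point or by an
  ordered pair; injectivity keeps the indicators independent.\<close>

lemma sbm_chernoff:
  fixes \<phi> :: "'j \<Rightarrow> nat set"
  assumes "p \<in> {0..1}" "q \<in> {0..1}" "inj_on \<phi> J" "\<phi> ` J \<subseteq> vertex_pairs N"
  shows "measure_pmf.prob (sbm M N B p q) {E. t * x \<le> t * (\<Sum>j\<in>J. of_bool (\<phi> j \<in> E))}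
    \<le> exp ((exp t - 1) * (\<Sum>j\<in>J. edge_prob M B p q (\<phi> j)) - t * x)"
proof -
  have "(\<Sum>j\<in>J. of_bool (\<phi> j \<in> {e \<in> vertex_pairs N. a e})) = (\<Sum>e\<in>\<phi> ` J. of_bool (a e) :: real)" for a
    using assms by (subst sum.reindex) (auto intro!: sum.cong)
  moreover have "(\<Sum>j\<in>J. edge_prob M B p q (\<phi> j)) = (\<Sum>e\<in>\<phi> ` J. edge_prob M B p q e)"
    using assms by (subst sum.reindex) auto
  ultimately show ?thesis
    unfolding prob_sbm
    using bernoulli_product_chernoff[OF finite_vertex_pairs assms(4) edge_prob_bounds[OF assms(1,2)]] by simp
qed

lemma sbm_lower_tail:
  fixes \<phi> :: "'j \<Rightarrow> nat set"
  assumes "p \<in> {0..1}" "q \<in> {0..1}" "inj_on \<phi> J" "\<phi> ` J \<subseteq> vertex_pairs N"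
    and \<mu>: "0 \<le> \<mu>" "\<mu> \<le> (\<Sum>j\<in>J. edge_prob M B p q (\<phi> j))"
  shows "measure_pmf.prob (sbm M N B p q) {E. (\<Sum>j\<in>J. of_bool (\<phi> j \<in> E)) \<le> \<mu> / 4} \<le> exp (- \<mu> / 4)"
proof -
  define m where "m = (\<Sum>j\<in>J. edge_prob M B p q (\<phi> j))"
  have "2 \<le> exp (1::real)" using exp_ge_add_one_self[of "1::real"] by simp
  then have "exp (- 1) \<le> (1 / 2 :: real)" by (simp add: exp_minus field_simps)
  then have "exp (- 1) * m \<le> 1 / 2 * m"
    using \<mu> by (intro mult_right_mono) (auto simp: m_def)
  \<comment> \<open>The choice \<open>t = -1\<close> makes the exponent at most
    \<open>- \<mu> / 2 + \<mu> / 4\<close>.\<close>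
  then have le: "(exp (- 1) - 1) * m + \<mu> / 4 \<le> - \<mu> / 4"
    using \<mu> unfolding m_def[symmetric] by (simp add: left_diff_distrib)
  have "measure_pmf.prob (sbm M N B p q) {E. (\<Sum>j\<in>J. of_bool (\<phi> j \<in> E)) \<le> \<mu> / 4} \<le> exp ((exp (- 1) - 1) * m + \<mu> / 4)"
    using sbm_chernoff[OF assms(1-4), where t = "-1" and x = "\<mu> / 4", of M B] by (simp add: m_def)
  also have "\<dots> \<le> exp (- \<mu> / 4)" using le by simp
  finally show ?thesis .
qed

lemma sbm_upper_tail:
  fixes \<phi> :: "'j \<Rightarrow> nat set"
  assumes "p \<in> {0..1}" "q \<in> {0..1}" "inj_on \<phi> J" "\<phi> ` J \<subseteq> vertex_pairs N"
    and \<mu>: "0 \<le> \<mu>" "(\<Sum>j\<in>J. edge_prob M B p q (\<phi> j)) = \<mu>"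
  shows "measure_pmf.prob (sbm M N B p q) {E. 4 * \<mu> \<le> (\<Sum>j\<in>J. of_bool (\<phi> j \<in> E))} \<le> exp (- \<mu>)"
proof -
  have "(exp 1 - 1) * \<mu> \<le> 2 * \<mu>"
    using exp_le \<mu> by (intro mult_right_mono) auto
  \<comment> \<open>With \<open>t = 1\<close> and \<open>exp 1 \<le> 3\<close> the exponent is at
    most \<open>2 * \<mu> - 4 * \<mu>\<close>.\<close>
  then have le: "(exp 1 - 1) * \<mu> - 4 * \<mu> \<le> - \<mu>" using \<mu> by simp
  have "measure_pmf.prob (sbm M N B p q) {E. 4 * \<mu> \<le> (\<Sum>j\<in>J. of_bool (\<phi> j \<in> E))} \<le> exp ((exp 1 - 1) * \<mu> - 4 * \<mu>)"
    using sbm_chernoff[OF assms(1-4), where t = 1 and x = "4 * \<mu>", of M B] \<mu> by simp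
  also have "\<dots> \<le> exp (- \<mu>)" using le by simp
  finally show ?thesis .
qed

text \<open>The binomial theorem, summed over subsets instead of their sizes.\<close>

lemma sum_Pow_power_card:
  fixes x :: real
  assumes "finite V"
  shows "(\<Sum>S\<in>Pow V. x ^ card S) = (1 + x) ^ card V"
proof -
  have "(\<Prod>v\<in>V. x + 1) = (\<Sum>S\<in>Pow V. (\<Prod>v\<in>S. x) * (\<Prod>v\<in>V - S. 1))"
    by (rule prod_add) fact
  then show ?thesis by (simp add: add.commute)
qed

lemma inj_on_pair_set: "S \<inter> T = {} \<Longrightarrow> inj_on (\<lambda>(v, w). {v, w}) (S \<times> T)"
  by (auto simp: inj_on_def doubleton_eq_iff)

section \<open>Expected degrees and expected cuts\<close>

lemma equal_blocks_unique:
  assumes "equal_blocks M N B" "i \<in> {1..M}" "j \<in> {1..M}" "v \<in> B i" "v \<in> B j"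
  shows "i = j"
  using assms unfolding equal_blocks_def disjoint_family_on_def by blast

lemma equal_blocks_subset: "equal_blocks M N B \<Longrightarrow> i \<in> {1..M} \<Longrightarrow> B i \<subseteq> {1..N}"
  unfolding equal_blocks_def by blast

lemma equal_blocks_card:
  assumes "equal_blocks M N B" "M dvd N" "i \<in> {1..M}"
  shows "real (card (B i)) = N / M"
  using assms unfolding equal_blocks_def by (auto simp: real_of_nat_div)

lemma expected_degree:
  assumes B: "equal_blocks M N B" "M dvd N" and "v \<in> {1..N}"
  shows "(\<Sum>w\<in>{1..N}. edge_prob M B p q {v, w}) = (N * p + N * (real M - 1) * q) / M"
proof -
  obtain i where i: "i \<in> {1..M}" "v \<in> B i"
    using assms unfolding equal_blocks_def by blast
  have sub: "B i \<subseteq> {1..N}" using equal_blocks_subset[OF B(1) i(1)] .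
  have "(\<exists>j\<in>{1..M}. {v, w} \<subseteq> B j) \<longleftrightarrow> w \<in> B i" for w
    using i equal_blocks_unique[OF B(1) _ i(1) _ i(2)] by blast
  then have "edge_prob M B p q {v, w} = (if w \<in> B i then p else q)" for w
    by (simp only: edge_prob_def)
  then have "(\<Sum>w\<in>{1..N}. edge_prob M B p q {v, w}) = (\<Sum>w\<in>{1..N}. q + (if w \<in> B i then p - q else 0))"
    by (intro sum.cong) auto
  also have "\<dots> = N * q + card (B i) * (p - q)"
    using sub by (simp add: sum.distrib sum.If_cases Int_absorb1)
  also have "real (card (B i)) = N / M" by (rule equal_blocks_card[OF B i(1)])
  finally show ?thesis using i by (simp add: field_simps)
qed

lemma expected_cut_one_block:
  assumes "equal_blocks 1 N B" "S \<subseteq> {1..N}"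
  shows "(\<Sum>v\<in>S. \<Sum>w\<in>{1..N} - S. edge_prob 1 B p q {v, w}) = p * card S * card ({1..N} - S)"
proof -
  have "B 1 = {1..N}" using assms by (simp add: equal_blocks_def)
  then have "(\<Sum>v\<in>S. \<Sum>w\<in>{1..N} - S. edge_prob 1 B p q {v, w}) = (\<Sum>v\<in>S. \<Sum>w\<in>{1..N} - S. p)"
    using assms by (intro sum.cong refl) (auto simp: edge_prob_def)
  then show ?thesis by simp
qed

text \<open>At most half of the pairs from \<open>S\<close> to its complement lie in a common block,
  by the Cauchy-Schwarz inequality and \<open>2 \<le> M\<close>. Only the remaining pairs, of
  probability \<open>q\<close>, are counted.\<close>

lemma expected_cut_lower:
  fixes p q :: real
  assumes B: "equal_blocks M N B" "M dvd N" and "2 \<le> M" "0 \<le> p" "0 \<le> q" and S: "S \<subseteq> {1..N}"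
  shows "q * card S * card ({1..N} - S) / 2 \<le> (\<Sum>v\<in>S. \<Sum>w\<in>{1..N} - S. edge_prob M B p q {v, w})"
proof -
  define n where "n = real N / M"
  define T where "T = {1..N} - S"
  define s where "s i = real (card (S \<inter> B i))" for i
  have fin: "finite S" "finite T" using S finite_subset unfolding T_def by auto
  have cardT: "real (card T) = real N - real (card S)"
  proof -
    have "card S \<le> N" using card_mono[OF _ S] by simp
    then show ?thesis unfolding T_def using S fin by (simp add: card_Diff_subset of_nat_diff)
  qed
  have Ti: "real (card (T \<inter> B i)) = n - s i" if i: "i \<in> {1..M}" for i
  proof -
    have "T \<inter> B i = B i - S \<inter> B i"
      using equal_blocks_subset[OF B(1) i] by (auto simp: T_def)
    moreover have "finite (B i)" using equal_blocks_subset[OF B(1) i] finite_subset by blast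
    ultimately have "real (card (T \<inter> B i)) = card (B i) - s i"
      unfolding s_def by (simp add: card_Diff_subset card_mono of_nat_diff)
    then show ?thesis using equal_blocks_card[OF B i] by (simp add: n_def)
  qed
  have sum_s: "(\<Sum>i\<in>{1..M}. s i) = card S"
  proof -
    have "S = (\<Union>i\<in>{1..M}. S \<inter> B i)" using S B unfolding equal_blocks_def by blast
    moreover have "card (\<Union>i\<in>{1..M}. S \<inter> B i) = (\<Sum>i\<in>{1..M}. card (S \<inter> B i))"
      using fin equal_blocks_unique[OF B(1)] by (intro card_UN_disjoint) auto
    ultimately show ?thesis unfolding s_def by (metis of_nat_sum)
  qed
  have same: "(\<Sum>v\<in>S. \<Sum>w\<in>T. of_bool (\<exists>i\<in>{1..M}. {v, w} \<subseteq> B i)) \<le> (\<Sum>i\<in>{1..M}. s i * (n - s i))"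
  proof -
    have "(\<Sum>v\<in>S. \<Sum>w\<in>T. of_bool (\<exists>i\<in>{1..M}. {v, w} \<subseteq> B i)) \<le>
        (\<Sum>v\<in>S. \<Sum>w\<in>T. \<Sum>i\<in>{1..M}. of_bool (v \<in> B i) * of_bool (w \<in> B i) :: real)"
    proof (intro sum_mono)
      fix v w
      show "of_bool (\<exists>i\<in>{1..M}. {v, w} \<subseteq> B i) \<le> (\<Sum>i\<in>{1..M}. of_bool (v \<in> B i) * of_bool (w \<in> B i) :: real)"
      proof (cases "\<exists>i\<in>{1..M}. {v, w} \<subseteq> B i")
        case True
        then obtain i where i: "i \<in> {1..M}" "v \<in> B i" "w \<in> B i" by auto
        have "of_bool (v \<in> B i) * of_bool (w \<in> B i) \<le> (\<Sum>i\<in>{1..M}. of_bool (v \<in> B i) * of_bool (w \<in> B i) :: real)"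
          by (rule member_le_sum) (use i in auto)
        then show ?thesis using True i by simp
      qed (auto intro: sum_nonneg)
    qed
    also have "\<dots> = (\<Sum>v\<in>S. \<Sum>i\<in>{1..M}. \<Sum>w\<in>T. of_bool (v \<in> B i) * of_bool (w \<in> B i))"
      by (rule sum.cong[OF refl]) (rule sum.swap)
    also have "\<dots> = (\<Sum>i\<in>{1..M}. \<Sum>v\<in>S. \<Sum>w\<in>T. of_bool (v \<in> B i) * of_bool (w \<in> B i))"
      by (rule sum.swap)
    also have "\<dots> = (\<Sum>i\<in>{1..M}. (\<Sum>v\<in>S. of_bool (v \<in> B i)) * (\<Sum>w\<in>T. of_bool (w \<in> B i)))"
      by (simp only: sum_product)
    also have "\<dots> = (\<Sum>i\<in>{1..M}. s i * (n - s i))"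
    proof (rule sum.cong[OF refl])
      fix i assume i: "i \<in> {1..M}"
      have "(\<Sum>v\<in>X. of_bool (v \<in> B i)) = real (card (X \<inter> B i))" if "finite X" for X
        using that by simp
      then show "(\<Sum>v\<in>S. of_bool (v \<in> B i)) * (\<Sum>w\<in>T. of_bool (w \<in> B i)) = s i * (n - s i)"
        using fin by (simp only: Ti[OF i, unfolded s_def] s_def)
    qed
    finally show ?thesis .
  qed
  \<comment> \<open>Cauchy-Schwarz over the blocks: the number of pairs inside blocks is largest
    when \<open>S\<close> is spread evenly.\<close>
  have "(real (card S))\<^sup>2 \<le> (\<Sum>i\<in>{1..M}. (s i)\<^sup>2) * M"
    using sum_squared_le_sum_of_squares[of s "{1..M}"] by (simp add: sum_s)
  then have sq: "(real (card S))\<^sup>2 / M \<le> (\<Sum>i\<in>{1..M}. (s i)\<^sup>2)"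
    using \<open>2 \<le> M\<close> by (simp add: field_simps)
  have "(\<Sum>i\<in>{1..M}. s i * (n - s i)) = n * card S - (\<Sum>i\<in>{1..M}. (s i)\<^sup>2)"
    by (simp add: algebra_simps power2_eq_square sum_subtractf sum_s[symmetric] sum_distrib_left)
  also have "\<dots> \<le> n * card S - (real (card S))\<^sup>2 / M" using sq by simp
  also have "\<dots> = card S * card T / M"
    by (simp add: cardT n_def algebra_simps power2_eq_square flip: diff_divide_distrib add_divide_distrib)
  also have "\<dots> \<le> card S * card T / 2"
    using \<open>2 \<le> M\<close> by (intro divide_left_mono) auto
  finally have same': "(\<Sum>v\<in>S. \<Sum>w\<in>T. of_bool (\<exists>i\<in>{1..M}. {v, w} \<subseteq> B i)) \<le> card S * card T / (2 :: real)"
    using same by linarith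
  have "q * card S * card T / 2 \<le> q * (real (card S) * real (card T) - (\<Sum>v\<in>S. \<Sum>w\<in>T. of_bool (\<exists>i\<in>{1..M}. {v, w} \<subseteq> B i)))"
    using mult_left_mono[OF same' \<open>0 \<le> q\<close>] by (simp add: algebra_simps)
  also have "\<dots> = (\<Sum>v\<in>S. \<Sum>w\<in>T. q * (1 - of_bool (\<exists>i\<in>{1..M}. {v, w} \<subseteq> B i)))"
    by (simp add: sum_subtractf right_diff_distrib sum_distrib_left)
  also have "\<dots> \<le> (\<Sum>v\<in>S. \<Sum>w\<in>T. edge_prob M B p q {v, w})"
    using \<open>0 \<le> p\<close> by (intro sum_mono) (auto simp: edge_prob_def)
  finally show ?thesis by (simp add: T_def)
qed

lemma pair_in_vertex_pairs: "v \<in> {1..N} \<Longrightarrow> w \<in> {1..N} \<Longrightarrow> {v, w} \<in> vertex_pairs N"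
  unfolding vertex_pairs_def by blast

section \<open>Union bound over vertices and cuts\<close>

text \<open>The larger of \<open>S\<close> and its complement has at least half of the vertices, so
  each summand is at most \<open>x\<close> to the size of the smaller part. Adding both powers
  avoids a case distinction in the sum.\<close>

lemma sum_cuts_le:
  fixes V :: "'a set" and r :: real
  assumes V: "finite V" and r: "0 \<le> r"
  defines "x \<equiv> exp (- r * card V / 16)"
  shows "(\<Sum>S\<in>Pow V - {{}, V}. exp (- (r * card S * card (V - S) / 2) / 4)) \<le> 2 * ((1 + x) ^ card V - 1)"
proof -
  let ?A = "Pow V - {{}, V}"
  have x: "0 < x" "x \<le> 1" using r by (auto simp: x_def)
  have "exp (- (r * card S * card (V - S) / 2) / 4) \<le> x ^ card S + x ^ card (V - S)" if "S \<in> ?A" for S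
  proof -
    define s t where "s = real (card S)" and "t = real (card (V - S))"
    have st: "s + t = card V" "0 \<le> s" "0 \<le> t"
      using V that by (auto simp: s_def t_def card_Diff_subset finite_subset card_mono of_nat_diff)
    have pow: "x ^ k = exp (- r * (s + t) / 16 * k)" for k
      by (simp add: x_def st flip: exp_of_nat_mult)
    have key: "exp (- (r * a * b / 2) / 4) \<le> exp (- r * (a + b) / 16 * a)" if "a \<le> b" "0 \<le> a" for a b
    proof -
      have "r * (a * (a + b)) \<le> r * (a * (2 * b))"
        using that r by (intro mult_left_mono) auto
      then show ?thesis by (simp add: algebra_simps)
    qed
    show ?thesis
    proof (cases "s \<le> t")
      case True
      then have "exp (- (r * s * t / 2) / 4) \<le> x ^ card S"
        using key[of s t] st by (simp add: pow s_def)
      then show ?thesis using x by (simp add: s_def t_def add_increasing2)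
    next
      case False
      then have "exp (- (r * t * s / 2) / 4) \<le> x ^ card (V - S)"
        using key[of t s] False st unfolding pow t_def[symmetric] add.commute[of s t] by simp
      then show ?thesis using x by (simp add: s_def t_def add_increasing mult_ac)
    qed
  qed
  then have "(\<Sum>S\<in>?A. exp (- (r * card S * card (V - S) / 2) / 4)) \<le> (\<Sum>S\<in>?A. x ^ card S + x ^ card (V - S))"
    by (rule sum_mono)
  also have "\<dots> = (\<Sum>S\<in>?A. x ^ card S) + (\<Sum>S\<in>?A. x ^ card (V - S))"
    by (rule sum.distrib)
  also have "(\<Sum>S\<in>?A. x ^ card (V - S)) = (\<Sum>S\<in>?A. x ^ card S)"
    by (rule sum.reindex_bij_witness[of _ "\<lambda>S. V - S" "\<lambda>S. V - S"]) (auto simp: double_diff)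
  also have "(\<Sum>S\<in>?A. x ^ card S) \<le> (\<Sum>S\<in>Pow V - {{}}. x ^ card S)"
    using V x by (intro sum_mono2) auto
  also have "\<dots> = (1 + x) ^ card V - 1"
    using V sum_Pow_power_card[of V x] by (simp add: sum_diff1)
  finally show ?thesis by simp
qed

text \<open>The constants come from the tail bounds: a quarter and four times the expectation, and
  for cuts a quarter of \<open>r / 2\<close>. The factor \<open>N\<close> on both sides matches the
  cut hypothesis of \<open>mean_hitting_time_bounds\<close> with
  \<open>c = r * N / 8\<close>.\<close>

definition typical :: "nat \<Rightarrow> real \<Rightarrow> real \<Rightarrow> nat set set \<Rightarrow> bool" where
  "typical N D r E \<longleftrightarrow> E \<subseteq> vertex_pairs N \<and>
     (\<forall>u\<in>{1..N}. D / 4 \<le> real (vertex_degree N E u) \<and> real (vertex_degree N E u) \<le> 4 * D) \<and>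
     (\<forall>S\<subseteq>{1..N}. r * N / 8 * card S * card ({1..N} - S) \<le> N * (\<Sum>v\<in>S. \<Sum>w\<in>{1..N} - S. adj E v w))"

lemma prob_not_typical:
  fixes p q r D :: real
  assumes pq: "p \<in> {0..1}" "q \<in> {0..1}" and "0 \<le> r" "0 \<le> D"
    and degree: "\<And>u. u \<in> {1..N} \<Longrightarrow> (\<Sum>w\<in>{1..N}. edge_prob M B p q {u, w}) = D"
    and cut: "\<And>S. S \<subseteq> {1..N} \<Longrightarrow>
      r * card S * card ({1..N} - S) / 2 \<le> (\<Sum>v\<in>S. \<Sum>w\<in>{1..N} - S. edge_prob M B p q {v, w})"
  shows "measure_pmf.prob (sbm M N B p q) {E. \<not> typical N D r E}
    \<le> 2 * ((1 + exp (- r * N / 16)) ^ N - 1) + N * (2 * exp (- D / 4))"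
proof -
  let ?P = "sbm M N B p q" and ?V = "{1..N}"
  define low where "low u = {E. (\<Sum>w\<in>?V. of_bool ({u, w} \<in> E)) \<le> D / 4}" for u
  define high where "high u = {E. 4 * D \<le> (\<Sum>w\<in>?V. of_bool ({u, w} \<in> E))}" for u
  define sparse where "sparse S = {E. (\<Sum>z\<in>S \<times> (?V - S). of_bool ((case z of (v, w) \<Rightarrow> {v, w}) \<in> E))
      \<le> r * card S * card (?V - S) / 2 / 4}" for S
  have incl: "{E. \<not> typical N D r E} \<subseteq>
      {E. \<not> E \<subseteq> vertex_pairs N} \<union> (\<Union>u\<in>?V. low u \<union> high u) \<union> (\<Union>S\<in>Pow ?V - {{}, ?V}. sparse S)"
  proof
    fix E assume "E \<in> {E. \<not> typical N D r E}"
    then consider "\<not> E \<subseteq> vertex_pairs N"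
      | u where "u \<in> ?V" "vertex_degree N E u < D / 4"
      | u where "u \<in> ?V" "4 * D < vertex_degree N E u"
      | S where "S \<subseteq> ?V" "N * (\<Sum>v\<in>S. \<Sum>w\<in>?V - S. adj E v w) < r * N / 8 * card S * card (?V - S)"
      unfolding typical_def by (auto simp: not_le)
    then show "E \<in> {E. \<not> E \<subseteq> vertex_pairs N} \<union> (\<Union>u\<in>?V. low u \<union> high u) \<union> (\<Union>S\<in>Pow ?V - {{}, ?V}. sparse S)"
    proof cases
      case 1 then show ?thesis by simp
    next
      case (2 u)
      then have "E \<in> low u" by (simp add: low_def vertex_degree_def del: sum_of_bool_eq)
      then show ?thesis using 2 by blast
    next
      case (3 u)
      then have "E \<in> high u" by (simp add: high_def vertex_degree_def del: sum_of_bool_eq)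
      then show ?thesis using 3 by blast
    next
      case (4 S)
      \<comment> \<open>For the empty set and the whole vertex set both sides are 0, so the strict
        inequality fails.\<close>
      then have "S \<in> Pow ?V - {{}, ?V}" by auto
      moreover have "0 < real N" using 4 by (cases N) auto
      then have "(\<Sum>v\<in>S. \<Sum>w\<in>?V - S. adj E v w) < r * card S * card (?V - S) / 8"
        using 4 by (simp add: field_simps)
      then have "E \<in> sparse S"
        by (simp add: sparse_def adj_def sum.cartesian_product case_prod_unfold del: sum_of_bool_eq)
      ultimately show ?thesis by blast
    qed
  qed
  have "measure_pmf.prob ?P {E. \<not> typical N D r E} \<le>
      measure_pmf.prob ?P ({E. \<not> E \<subseteq> vertex_pairs N} \<union> (\<Union>u\<in>?V. low u \<union> high u) \<union> (\<Union>S\<in>Pow ?V - {{}, ?V}. sparse S))"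
    by (rule measure_pmf.finite_measure_mono[OF incl]) simp
  also have "\<dots> \<le> measure_pmf.prob ?P {E. \<not> E \<subseteq> vertex_pairs N}
      + measure_pmf.prob ?P (\<Union>u\<in>?V. low u \<union> high u) + measure_pmf.prob ?P (\<Union>S\<in>Pow ?V - {{}, ?V}. sparse S)"
    by (intro order_trans[OF measure_Un_le] add_right_mono measure_Un_le) auto
  also have "measure_pmf.prob ?P {E. \<not> E \<subseteq> vertex_pairs N} = 0"
    by (auto simp: measure_pmf_zero_iff sbm_def)
  also have "measure_pmf.prob ?P (\<Union>u\<in>?V. low u \<union> high u) \<le> (\<Sum>u\<in>?V. measure_pmf.prob ?P (low u \<union> high u))"
    by (rule measure_UNION_le) auto
  also have "\<dots> \<le> (\<Sum>u\<in>?V. 2 * exp (- D / 4))"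
  proof (rule sum_mono)
    fix u assume u: "u \<in> ?V"
    have inj: "inj_on (\<lambda>w. {u, w}) ?V" by (auto simp: inj_on_def doubleton_eq_iff)
    have sub: "(\<lambda>w. {u, w}) ` ?V \<subseteq> vertex_pairs N" using u by (auto intro!: pair_in_vertex_pairs)
    have "measure_pmf.prob ?P (low u) \<le> exp (- D / 4)"
      unfolding low_def by (rule sbm_lower_tail[OF pq inj sub]) (use degree[OF u] \<open>0 \<le> D\<close> in auto)
    moreover have "measure_pmf.prob ?P (high u) \<le> exp (- D)"
      unfolding high_def by (rule sbm_upper_tail[OF pq inj sub]) (use degree[OF u] \<open>0 \<le> D\<close> in auto)
    moreover have "exp (- D) \<le> exp (- D / 4)" using \<open>0 \<le> D\<close> by simp
    moreover have "measure_pmf.prob ?P (low u \<union> high u) \<le> measure_pmf.prob ?P (low u) + measure_pmf.prob ?P (high u)"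
      by (rule measure_Un_le) auto
    ultimately show "measure_pmf.prob ?P (low u \<union> high u) \<le> 2 * exp (- D / 4)" by linarith
  qed
  also have "measure_pmf.prob ?P (\<Union>S\<in>Pow ?V - {{}, ?V}. sparse S) \<le> (\<Sum>S\<in>Pow ?V - {{}, ?V}. measure_pmf.prob ?P (sparse S))"
    by (rule measure_UNION_le) auto
  also have "\<dots> \<le> (\<Sum>S\<in>Pow ?V - {{}, ?V}. exp (- (r * card S * card (?V - S) / 2) / 4))"
  proof (rule sum_mono)
    fix S assume S: "S \<in> Pow ?V - {{}, ?V}"
    have inj: "inj_on (\<lambda>(v, w). {v, w}) (S \<times> (?V - S))" by (rule inj_on_pair_set) auto
    have sub: "(\<lambda>(v, w). {v, w}) ` (S \<times> (?V - S)) \<subseteq> vertex_pairs N" using S by (auto intro!: pair_in_vertex_pairs)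
    have "r * card S * card (?V - S) / 2 \<le> (\<Sum>z\<in>S \<times> (?V - S). edge_prob M B p q (case z of (v, w) \<Rightarrow> {v, w}))"
      using cut[of S] S by (simp add: sum.cartesian_product case_prod_unfold)
    then show "measure_pmf.prob ?P (sparse S) \<le> exp (- (r * card S * card (?V - S) / 2) / 4)"
      unfolding sparse_def by (intro sbm_lower_tail[OF pq inj sub]) (use \<open>0 \<le> r\<close> in auto)
  qed
  also have "\<dots> \<le> 2 * ((1 + exp (- r * N / 16)) ^ N - 1)"
    using sum_cuts_le[of ?V r] \<open>0 \<le> r\<close> by simp
  finally show ?thesis by simp
qed

lemma typical_hitting_time:
  assumes typical: "typical N D r E" and "2 \<le> N" "0 < D" "0 < r" and v: "v \<in> {1..N}"
  shows "connected_graph N E"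
    and "\<bar>enn2ereal (mean_hitting_time N E v) / ereal (real N) - 1\<bar> \<le> ereal (2 / N + 4 / D + 131072 * (D / (r * N)\<^sup>2))"
proof -
  have N: "0 < real N" using \<open>2 \<le> N\<close> by simp
  have c: "0 < r * N / 8" using \<open>0 < r\<close> N by simp
  have sub: "E \<subseteq> vertex_pairs N"
    and deg: "\<And>u. u \<in> {1..N} \<Longrightarrow> D / 4 \<le> real (vertex_degree N E u)"
      "\<And>u. u \<in> {1..N} \<Longrightarrow> real (vertex_degree N E u) \<le> 4 * D"
    and cut: "\<And>S. S \<subseteq> {1..N} \<Longrightarrow> r * N / 8 * card S * card ({1..N} - S) \<le> N * (\<Sum>v\<in>S. \<Sum>w\<in>{1..N} - S. adj E v w)"
    using typical by (auto simp: typical_def)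
  show "connected_graph N E"
    by (rule connected_graph_of_cuts[OF c cut])
  have "finite E" using sub finite_vertex_pairs by (rule finite_subset)
  then obtain x where x: "mean_hitting_time N E v = ennreal x" "real N - 2 \<le> x"
    "x \<le> N * (1 + 1 / (D / 4) + 32 * (4 * D)\<^sup>2 / ((r * N / 8)\<^sup>2 * (D / 4)))"
    using mean_hitting_time_bounds[OF sub _ v c _ _ deg cut] \<open>0 < D\<close> by auto
  \<comment> \<open>The error term for \<open>dmin = D / 4\<close>, \<open>\<Delta> = 4 * D\<close>
    and \<open>c = r * N / 8\<close>; the constant is 32 * 16 * 64 * 4.\<close>
  have "32 * (4 * D)\<^sup>2 / ((r * N / 8)\<^sup>2 * (D / 4)) = 131072 * (D / (r * N)\<^sup>2)"
    using \<open>0 < D\<close> c by (simp add: power2_eq_square field_simps)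
  with x have "x / N \<le> 1 + (4 / D + 131072 * (D / (r * N)\<^sup>2))"
    using N by (simp add: pos_divide_le_eq mult.commute add.assoc)
  moreover have "1 - 2 / N \<le> x / N"
    using divide_right_mono[OF x(2), of N] N by (simp add: diff_divide_distrib)
  moreover have "0 \<le> 2 / N" "0 \<le> 4 / D" "0 \<le> 131072 * (D / (r * N)\<^sup>2)" using \<open>0 < D\<close> by auto
  ultimately have "\<bar>x / N - 1\<bar> \<le> 2 / N + 4 / D + 131072 * (D / (r * N)\<^sup>2)"
    by (simp only: abs_le_iff) linarith
  \<comment> \<open>Nonnegativity matters because \<open>ennreal\<close> sends negative reals to
    0.\<close>
  moreover have "0 \<le> x" using x \<open>2 \<le> N\<close> by simp
  ultimately show "\<bar>enn2ereal (mean_hitting_time N E v) / ereal (real N) - 1\<bar> \<le> ereal (2 / N + 4 / D + 131072 * (D / (r * N)\<^sup>2))"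
    using N unfolding x(1) by (simp add: enn2ereal_ennreal one_ereal_def)
qed

section \<open>Asymptotics along admissible sizes\<close>

lemma eventually_sizes: "eventually P (sizes M) \<longleftrightarrow> (\<forall>\<^sub>F N in sequentially. admissible M N \<longrightarrow> P N)"
  by (simp add: sizes_def eventually_inf_principal)

lemma filterlim_sizes: "filterlim f F sequentially \<Longrightarrow> filterlim f F (sizes M)"
  unfolding sizes_def by (rule filterlim_mono) auto

theorem theorem8p1:
  fixes M :: nat and B :: "nat \<Rightarrow> nat \<Rightarrow> nat set" and p q :: "nat \<Rightarrow> real"
    and \<kappa> :: ennreal and v :: "nat \<Rightarrow> nat"
  assumes "M \<ge> 1"
    and "\<And>N. admissible M N \<Longrightarrow> equal_blocks M N (B N)"
    and "\<And>N. admissible M N \<Longrightarrow> p N \<in> {0..1} \<and> q N \<in> {0..1}"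
    and "dominates (sizes M) (\<lambda>N. real N * p N + real N * (real M - 1) * q N)
           (\<lambda>N. real M * ln (real N) ^ 4)"
    and "dominates (sizes M) q (\<lambda>N. sqrt (p N * ln (real N) / (real N * real M)))"
    and "((\<lambda>N. ennreal ((real M - 1) * q N) / ennreal (p N)) \<longlongrightarrow> \<kappa>) (sizes M)"
    and "\<And>N. admissible M N \<Longrightarrow> v N \<in> {1..N}"
  shows "\<exists>\<delta>. (\<delta> \<longlongrightarrow> 0) (sizes M) \<and>
           aas (sizes M) (\<lambda>N. sbm M N (B N) (p N) (q N))
             (\<lambda>N E. connected_graph N E \<and>
                \<bar>enn2ereal (mean_hitting_time N E (v N)) / ereal (real N) - 1\<bar> \<le> ereal (\<delta> N))"
proof -
  let ?F = "sizes M"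
  define D where "D N = (real N * p N + real N * (real M - 1) * q N) / M" for N
  define L where "L N = ln (real N)" for N
  define r where "r = (if M = 1 then p else q)"
  define b where "b N = sqrt (p N * L N / (real N * real M))" for N
  have M: "0 < real M" using \<open>M \<ge> 1\<close> by simp
  have adm: "\<forall>\<^sub>F N in ?F. admissible M N"
    by (simp add: eventually_sizes)
  have N2: "\<forall>\<^sub>F N in ?F. 2 \<le> N"
    using adm by eventually_elim (use \<open>M \<ge> 1\<close> in \<open>auto simp: admissible_def\<close>)
  have "filterlim L at_top ?F"
    unfolding L_def by (rule filterlim_sizes) real_asymp
  then have L1: "\<forall>\<^sub>F N in ?F. 1 \<le> L N" by (simp add: filterlim_at_top)
  have invL: "((\<lambda>N. 1 / L N) \<longlongrightarrow> 0) ?F"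
    unfolding L_def by (rule filterlim_sizes) real_asymp

  have D_pos: "\<forall>\<^sub>F N in ?F. 0 < D N"
    using assms(4) M unfolding dominates_def D_def by (auto elim!: eventually_mono)
  have LD: "((\<lambda>N. L N ^ 4 / D N) \<longlongrightarrow> 0) ?F"
    using assms(4) unfolding dominates_def D_def L_def by (simp add: mult.commute)
  \<comment> \<open>The constant is 1056 = 32^2 + 32; both summands are used in the contradiction
    proving \<open>qL\<close>.\<close>
  have LD_small: "\<forall>\<^sub>F N in ?F. 1056 * L N < D N"
  proof -
    have "\<forall>\<^sub>F N in ?F. L N ^ 4 / D N < 1 / 1056"
      using LD by (rule order_tendstoD) simp
    then show ?thesis
      using D_pos L1
    proof eventually_elim
      case (elim N)
      have "L N * 1 \<le> L N * L N ^ 3" using elim by (intro mult_left_mono) auto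
      then have "L N \<le> L N ^ 4" by (simp add: power4_eq_xxxx power3_eq_cube mult.assoc)
      moreover have "1056 * L N ^ 4 < D N" using elim by (simp add: field_simps)
      ultimately show ?case by linarith
    qed
  qed
  have invD: "((\<lambda>N. 1 / D N) \<longlongrightarrow> 0) ?F"
  proof (rule tendsto_sandwich[OF _ _ tendsto_const LD])
    show "\<forall>\<^sub>F N in ?F. 0 \<le> 1 / D N" using D_pos by eventually_elim simp
    show "\<forall>\<^sub>F N in ?F. 1 / D N \<le> L N ^ 4 / D N"
      using D_pos L1 by eventually_elim (simp add: divide_right_mono)
  qed

  have rL: "\<forall>\<^sub>F N in ?F. 32 * L N \<le> r N * N"
    and Dr: "((\<lambda>N. D N / (r N * N)\<^sup>2) \<longlongrightarrow> 0) ?F"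
  proof -
    have "(\<forall>\<^sub>F N in ?F. 32 * L N \<le> r N * N) \<and> ((\<lambda>N. D N / (r N * N)\<^sup>2) \<longlongrightarrow> 0) ?F"
    proof (cases "M = 1")
      case True
      then have D: "D N = r N * N" for N by (simp add: D_def r_def)
      have "\<forall>\<^sub>F N in ?F. 32 * L N \<le> r N * N"
        using LD_small L1 by eventually_elim (simp add: D)
      moreover have "D N / (r N * N)\<^sup>2 = 1 / D N" for N
        unfolding D[symmetric] by (simp add: power2_eq_square)
      ultimately show ?thesis using invD by simp
    next
      case False
      then have r: "r = q" and M2: "2 \<le> M" using \<open>M \<ge> 1\<close> by (auto simp: r_def)
      have q_pos: "\<forall>\<^sub>F N in ?F. 0 < q N" and bq: "((\<lambda>N. b N / q N) \<longlongrightarrow> 0) ?F"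
        using assms(5) by (auto simp: dominates_def b_def L_def)
      have "\<forall>\<^sub>F N in ?F. b N / q N < 1" using bq by (rule order_tendstoD) simp
      \<comment> \<open>If \<open>q N * N\<close> were below \<open>32 * L N\<close>, the large
        expected degree would have to come from \<open>p N\<close>. The squared bound
        \<open>b N < q N\<close>, which is \<open>pL\<close>, limits \<open>p N\<close> and excludes
        this.\<close>
      then have qL: "\<forall>\<^sub>F N in ?F. 32 * L N \<le> q N * N"
        using q_pos LD_small L1 N2 adm
      proof eventually_elim
        case (elim N)
        have N: "0 < real N" using elim by simp
        define y where "y = q N * N"
        have "0 \<le> p N" using assms(3) elim by auto
        have "b N < q N" using elim by simp
        moreover have "0 \<le> b N" using \<open>0 \<le> p N\<close> elim unfolding b_def by (intro real_sqrt_ge_zero) auto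
        ultimately have "(b N)\<^sup>2 < (q N)\<^sup>2" by (intro power_strict_mono) auto
        moreover have "(b N)\<^sup>2 = p N * L N / (N * M)"
          using \<open>0 \<le> p N\<close> elim by (simp add: b_def)
        ultimately have "p N * L N < (q N)\<^sup>2 * (N * M)"
          using N M by (simp add: pos_divide_less_eq)
        then have "p N * L N * N < (q N)\<^sup>2 * (N * M) * N"
          using N by (rule mult_strict_right_mono)
        then have pL: "(N * p N) * L N < M * y\<^sup>2"
          by (simp add: y_def power2_eq_square mult_ac)
        show ?case
        proof (rule ccontr)
          assume "\<not> 32 * L N \<le> q N * N"
          then have y: "0 \<le> y" "y \<le> 32 * L N" using elim by (auto simp: y_def)
          have "M * (1056 * L N) < N * p N + (real M - 1) * y"
            using elim M by (simp add: D_def y_def field_simps)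
          also have "(real M - 1) * y \<le> M * (32 * L N)"
            using y M2 by (intro mult_mono) auto
          finally have "M * (1024 * L N) < N * p N" by (simp add: algebra_simps)
          then have "M * (1024 * L N) * L N < N * p N * L N"
            using elim by (intro mult_strict_right_mono) auto
          moreover have "M * y\<^sup>2 \<le> M * (32 * L N)\<^sup>2"
            using y by (intro mult_left_mono power_mono) auto
          ultimately show False using pL by (simp add: power2_eq_square mult_ac)
        qed
      qed
      have "((\<lambda>N. (b N / q N)\<^sup>2 + 1 / L N) \<longlongrightarrow> 0\<^sup>2 + 0) ?F"
        by (intro tendsto_intros bq invL)
      then have lim: "((\<lambda>N. (b N / q N)\<^sup>2 + 1 / L N) \<longlongrightarrow> 0) ?F" by simp
      have "((\<lambda>N. D N / (q N * N)\<^sup>2) \<longlongrightarrow> 0) ?F"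
      proof (rule tendsto_sandwich[OF _ _ tendsto_const lim])
        show "\<forall>\<^sub>F N in ?F. 0 \<le> D N / (q N * N)\<^sup>2" using D_pos by eventually_elim simp
        show "\<forall>\<^sub>F N in ?F. D N / (q N * N)\<^sup>2 \<le> (b N / q N)\<^sup>2 + 1 / L N"
          using q_pos qL L1 N2 adm
        proof eventually_elim
          case (elim N)
          have N: "0 < real N" using elim by simp
          have "0 \<le> p N" using assms(3) elim by auto
          \<comment> \<open>The two contributions to the degree are treated separately: the first is
            at most \<open>(b N / q N)\<^sup>2\<close> since \<open>1 \<le> L N\<close>, the second
            at most \<open>1 / L N\<close> by \<open>qL\<close>.\<close>
          have "D N / (q N * N)\<^sup>2 = p N / (N * M) / (q N)\<^sup>2 + (real M - 1) / M * (1 / (q N * N))"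
            using N M elim by (simp add: D_def field_simps power2_eq_square)
          also have "p N / (N * M) / (q N)\<^sup>2 \<le> p N * L N / (N * M) / (q N)\<^sup>2"
            using \<open>0 \<le> p N\<close> elim mult_left_mono[of 1 "L N" "p N"] by (intro divide_right_mono) auto
          also have "\<dots> = (b N / q N)\<^sup>2"
            using \<open>0 \<le> p N\<close> elim by (simp add: b_def power_divide)
          also have "(real M - 1) / M * (1 / (q N * N)) \<le> 1 * (1 / L N)"
          proof (rule mult_mono)
            have "L N \<le> q N * N" using elim by simp
            then show "1 / (q N * N) \<le> 1 / L N" using elim by (intro divide_left_mono) auto
          qed (use elim M in auto)
          finally show ?case by simp
        qed
      qed
      with qL show ?thesis by (simp add: r)
    qed
    then show "\<forall>\<^sub>F N in ?F. 32 * L N \<le> r N * N" "((\<lambda>N. D N / (r N * N)\<^sup>2) \<longlongrightarrow> 0) ?F" by auto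
  qed

  define \<delta> where "\<delta> N = 2 / real N + 4 / D N + 131072 * (D N / (r N * N)\<^sup>2)" for N
  have "((\<lambda>N. 2 / real N + 4 * (1 / D N) + 131072 * (D N / (r N * N)\<^sup>2)) \<longlongrightarrow> 0 + 4 * 0 + 131072 * 0) ?F"
    by (intro tendsto_add tendsto_mult tendsto_const invD Dr filterlim_sizes) real_asymp
  then have \<delta>: "(\<delta> \<longlongrightarrow> 0) ?F"
    unfolding \<delta>_def by simp

  let ?Q = "\<lambda>N E. connected_graph N E \<and>
    \<bar>enn2ereal (mean_hitting_time N E (v N)) / ereal (real N) - 1\<bar> \<le> ereal (\<delta> N)"
  let ?prob = "\<lambda>N. measure_pmf.prob (sbm M N (B N) (p N) (q N))"
  \<comment> \<open>The first summand bounds the failure of some cut, the second the failure of some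
    degree.\<close>
  define err where "err N = 2 * (exp (1 / real N) - 1) + 2 / real N" for N
  have lower: "\<forall>\<^sub>F N in ?F. 1 - err N \<le> ?prob N {E. ?Q N E}"
    using adm N2 L1 D_pos LD_small rL
  proof eventually_elim
    case (elim N)
    have N: "0 < real N" using elim by simp
    have dvd: "M dvd N" using elim by (simp add: admissible_def)
    have pq: "p N \<in> {0..1}" "q N \<in> {0..1}" using assms(3) elim by auto
    note blocks = assms(2)[OF elim(1)]
    have "0 < r N * N" using elim by linarith
    then have r: "0 < r N" using N by (simp add: zero_less_mult_iff)
    have cut: "r N * card S * card ({1..N} - S) / 2 \<le> (\<Sum>v\<in>S. \<Sum>w\<in>{1..N} - S. edge_prob M (B N) (p N) (q N) {v, w})"
      if S: "S \<subseteq> {1..N}" for S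
    proof (cases "M = 1")
      case True
      then show ?thesis
        using expected_cut_one_block[of N "B N" S "p N" "q N"] blocks S pq by (simp add: r_def)
    next
      case False
      then show ?thesis
        using expected_cut_lower[OF blocks dvd _ _ _ S, of "p N" "q N"] pq \<open>M \<ge> 1\<close> by (simp add: r_def)
    qed
    \<comment> \<open>Both exponents \<open>r N * N / 16\<close> and \<open>D N / 4\<close> are at
      least \<open>2 * L N\<close>, by \<open>rL\<close> and \<open>LD_small\<close>. The resulting
      factor \<open>1 / N\<^sup>2\<close> beats the \<open>N\<close> vertices and the power
      \<open>N\<close> in the cut bound.\<close>
    have exp_L: "exp (- (2 * L N)) = 1 / (real N)\<^sup>2"
      using N by (simp add: L_def exp_minus exp_double inverse_eq_divide)
    define x where "x = exp (- r N * N / 16)"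
    have "x \<le> exp (- (2 * L N))" using elim by (simp add: x_def)
    then have x: "0 < x" "x \<le> 1 / (real N)\<^sup>2" unfolding exp_L by (auto simp: x_def)
    have "(1 + x) ^ N \<le> exp x ^ N" using x by (intro power_mono) auto
    also have "\<dots> = exp (N * x)" by (simp add: exp_of_nat_mult)
    also have "N * x \<le> 1 / N" using mult_left_mono[OF x(2), of N] N by (simp add: power2_eq_square)
    finally have 1: "(1 + x) ^ N \<le> exp (1 / N)" by simp
    have "exp (- D N / 4) \<le> exp (- (2 * L N))" using elim by simp
    then have "N * (2 * exp (- D N / 4)) \<le> N * (2 * (1 / (real N)\<^sup>2))"
      unfolding exp_L using N by (intro mult_left_mono) auto
    also have "\<dots> = 2 / N" using N by (simp add: power2_eq_square)
    finally have 2: "N * (2 * exp (- D N / 4)) \<le> 2 / N" .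
    have "?prob N {E. \<not> typical N (D N) (r N) E} \<le> 2 * ((1 + x) ^ N - 1) + N * (2 * exp (- D N / 4))"
      unfolding x_def
      by (rule prob_not_typical[OF pq])
         (use r elim cut expected_degree[OF blocks dvd] in \<open>auto simp: D_def\<close>)
    also have "\<dots> \<le> err N" using 1 2 by (simp add: err_def)
    finally have "?prob N {E. \<not> typical N (D N) (r N) E} \<le> err N" .
    \<comment> \<open>Typical graphs satisfy the conclusion deterministically, so the two events
      cover the whole space.\<close>
    moreover have "1 = ?prob N ({E. ?Q N E} \<union> {E. \<not> typical N (D N) (r N) E})"
    proof -
      have "?Q N E" if "typical N (D N) (r N) E" for E
        using typical_hitting_time[OF that _ _ r assms(7)[OF elim(1)]] elim by (simp add: \<delta>_def)
      then have "{E. ?Q N E} \<union> {E. \<not> typical N (D N) (r N) E} = UNIV" by blast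
      then show ?thesis by simp
    qed
    moreover have "?prob N ({E. ?Q N E} \<union> {E. \<not> typical N (D N) (r N) E}) \<le>
        ?prob N {E. ?Q N E} + ?prob N {E. \<not> typical N (D N) (r N) E}"
      by (rule measure_Un_le) auto
    ultimately show ?case by linarith
  qed
  have lim: "((\<lambda>N. 1 - err N) \<longlongrightarrow> 1) ?F"
    unfolding err_def by (rule filterlim_sizes) real_asymp
  have "aas ?F (\<lambda>N. sbm M N (B N) (p N) (q N)) ?Q"
    unfolding aas_def
    by (rule tendsto_sandwich[OF lower _ lim tendsto_const])
       (intro always_eventually allI measure_pmf.prob_le_1)
  with \<delta> show ?thesis by blast
qed

end
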